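(* Let $f:\Sigma\to\boldsymbol{R}^3_1$ be a mixed type surface in the Lorentz–Minkowski $3$-space $\boldsymbol{R}^3_1$, $p$ a lightlike point of the first kind, and $\kappa_L(p)$ the lightlike singular curvature at $p$. If $\kappa_L(p)$ is negative, then the image of $f$ is saddle shaped near $p$. On the other hand, if $\kappa_L(p)$ is positive, then the image of $f$ is locally convex near $p$, namely, locally lying on one side of its affine tangent plane.
   Context: All objects are smooth. $\boldsymbol{R}^3_1$ is $\boldsymbol{R}^3$ with metric $\langle\boldsymbol x,\boldsymbol x\rangle=x^2+y^2-z^2$ and its flat connection $\nabla$. A surface is an immersion $f:\Sigma\to\boldsymbol{R}^3_1$ of a connected $2$-manifold; $ds^2=f^*\langle\ ,\ \rangle$. A point is spacelike, timelike or lightlike if $ds^2$ there is positive definite, (non-degenerate) indefinite, or degenerate; $f$ is of mixed type if both the spacelike and timelike point sets are non-empty. $LD$ is the set of lightlike points. In local coordinates $ds^2=E\,du^2+2F\,du\,dv+G\,dv^2$, $\lambda=EG-F^2$. A lightlike point $p$ is non-degenerate if $d\lambda(p)\ne0$; then near $p$ the set $LD$ is the image of a regular curve $\gamma(t)$, $\gamma(0)=p$. At a lightlike point the null space $\{\boldsymbol v: ds^2(\boldsymbol v,\cdot)=0\}$ is one-dimensional; its nonzero elements are null vectors. A null vector field is a smooth vector field $\eta$ near $p$ with $\eta_q$ a null vector for all $q\in LD$. A non-degenerate lightlike point $p$ is of the first kind if $\gamma'(0)$ and $\eta_p$ are linearly independent. For such $p$, parametrize $\gamma$ so that $\hat\gamma=f\circ\gamma$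 satisfies $|\hat\gamma'|=1$, and let $\eta$ be a normalized null vector field, i.e. $\eta\langle df(\eta),df(\eta)\rangle=1$ along $LD$ (it exists, unique along $LD$). Then $\kappa_L(p)=\langle\nabla_t\hat\gamma'(t),df(\eta_{\gamma(t)})\rangle|_{t=0}$. "Saddle shaped near $p$" means that the Gaussian curvature of $f$, regarded as a surface in the Euclidean space $\boldsymbol{R}^3$, is negative near $p$. *)

theory Defs
  imports "HOL-Analysis.Analysis"
begin

section \<open>Smooth maps and smooth surfaces\<close>

text \<open>The sets \<open>S\<close> are meant to be open; \<open>Ck_on k\<close> asks for continuous partial derivatives
  up to order \<open>k\<close>.\<close>

primrec Ck_on ::
  "nat \<Rightarrow> ('a::euclidean_space) set \<Rightarrow> ('a \<Rightarrow> 'b::real_normed_vector) \<Rightarrow> bool"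
  where
    "Ck_on 0 S f \<longleftrightarrow> continuous_on S f"
  | "Ck_on (Suc k) S f \<longleftrightarrow>
       (\<forall>x\<in>S. f differentiable (at x)) \<and>
       (\<forall>b\<in>Basis. Ck_on k S (\<lambda>x. frechet_derivative f (at x) b))"

definition smooth_on ::
  "('a::euclidean_space) set \<Rightarrow> ('a \<Rightarrow> 'b::real_normed_vector) \<Rightarrow> bool"
  where "smooth_on S f \<longleftrightarrow> (\<forall>k. Ck_on k S f)"

text \<open>A chart is a pair of its domain and its coordinate map; \<open>coord_rep f c\<close> is the local
  representation of \<open>f\<close> on the coordinate domain \<open>coord_dom c\<close>.\<close>

type_synonym 'a chart = "'a set \<times> ('a \<Rightarrow> real^2)"

definition coord_dom :: "'a chart \<Rightarrow> (real^2) set"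
  where "coord_dom c = snd c ` fst c"

definition coord_rep :: "('a \<Rightarrow> 'b) \<Rightarrow> 'a chart \<Rightarrow> real^2 \<Rightarrow> 'b"
  where "coord_rep f c = f \<circ> inv_into (fst c) (snd c)"

definition smooth_2_manifold :: "'a topology \<Rightarrow> 'a chart set \<Rightarrow> bool"
  where "smooth_2_manifold X A \<longleftrightarrow>
    Hausdorff_space X \<and> second_countable X \<and>
    (\<Union>c\<in>A. fst c) = topspace X \<and>
    (\<forall>c\<in>A. openin X (fst c) \<and> open (coord_dom c) \<and>
       homeomorphic_map (subtopology X (fst c)) (top_of_set (coord_dom c)) (snd c)) \<and>
    (\<forall>c\<in>A. \<forall>d\<in>A. smooth_on (snd c ` (fst c \<inter> fst d)) (coord_rep (snd d) c))"

definition smooth_immersion :: "'a chart set \<Rightarrow> ('a \<Rightarrow> real^3) \<Rightarrow> bool"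
  where "smooth_immersion A f \<longleftrightarrow>
    (\<forall>c\<in>A. smooth_on (coord_dom c) (coord_rep f c) \<and>
       (\<forall>x\<in>coord_dom c. inj (frechet_derivative (coord_rep f c) (at x))))"

definition surface :: "'a topology \<Rightarrow> 'a chart set \<Rightarrow> ('a \<Rightarrow> real^3) \<Rightarrow> bool"
  where "surface X A f \<longleftrightarrow>
    smooth_2_manifold X A \<and> connected_space X \<and> smooth_immersion A f"


section \<open>The first fundamental form in Lorentz--Minkowski space\<close>

definition lorentz :: "real^3 \<Rightarrow> real^3 \<Rightarrow> real"
  where "lorentz v w = v $ 1 * w $ 1 + v $ 2 * w $ 2 - v $ 3 * w $ 3"

definition lorentz_norm :: "real^3 \<Rightarrow> real"
  where "lorentz_norm v = sqrt \<bar>lorentz v v\<bar>"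

text \<open>In this and the following two sections, \<open>g\<close> is the local representation of a surface
  on an open set \<open>D\<close>; tangent vectors of the surface are given by their two components with respect
  to the coordinates.\<close>

abbreviation tangent_map :: "(real^2 \<Rightarrow> real^3) \<Rightarrow> real^2 \<Rightarrow> real^2 \<Rightarrow> real^3"
  where "tangent_map g x v \<equiv> frechet_derivative g (at x) v"

definition ds2 :: "(real^2 \<Rightarrow> real^3) \<Rightarrow> real^2 \<Rightarrow> real^2 \<Rightarrow> real^2 \<Rightarrow> real"
  where "ds2 g x v w = lorentz (tangent_map g x v) (tangent_map g x w)"

definition null_vector :: "(real^2 \<Rightarrow> real^3) \<Rightarrow> real^2 \<Rightarrow> real^2 \<Rightarrow> bool"
  where "null_vector g x v \<longleftrightarrow> v \<noteq> 0 \<and> (\<forall>w. ds2 g x v w = 0)"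

definition spacelike_in :: "(real^2 \<Rightarrow> real^3) \<Rightarrow> real^2 \<Rightarrow> bool"
  where "spacelike_in g x \<longleftrightarrow> (\<forall>v. v \<noteq> 0 \<longrightarrow> ds2 g x v v > 0)"

definition lightlike_in :: "(real^2 \<Rightarrow> real^3) \<Rightarrow> real^2 \<Rightarrow> bool"
  where "lightlike_in g x \<longleftrightarrow> (\<exists>v. null_vector g x v)"

definition timelike_in :: "(real^2 \<Rightarrow> real^3) \<Rightarrow> real^2 \<Rightarrow> bool"
  where "timelike_in g x \<longleftrightarrow>
    \<not> lightlike_in g x \<and> (\<exists>v. ds2 g x v v > 0) \<and> (\<exists>v. ds2 g x v v < 0)"

definition LD_in :: "(real^2 \<Rightarrow> real^3) \<Rightarrow> (real^2) set \<Rightarrow> (real^2) set"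
  where "LD_in g D = {x \<in> D. lightlike_in g x}"

definition mixed_type :: "'a chart set \<Rightarrow> ('a \<Rightarrow> real^3) \<Rightarrow> bool"
  where "mixed_type A f \<longleftrightarrow>
    (\<exists>c\<in>A. \<exists>x\<in>coord_dom c. spacelike_in (coord_rep f c) x) \<and>
    (\<exists>c\<in>A. \<exists>x\<in>coord_dom c. timelike_in (coord_rep f c) x)"

definition discriminant :: "(real^2 \<Rightarrow> real^3) \<Rightarrow> real^2 \<Rightarrow> real"
  where "discriminant g x =
    ds2 g x (axis 1 1) (axis 1 1) * ds2 g x (axis 2 1) (axis 2 1)
      - (ds2 g x (axis 1 1) (axis 2 1))\<^sup>2"

definition nondegenerate_lightlike_in :: "(real^2 \<Rightarrow> real^3) \<Rightarrow> real^2 \<Rightarrow> bool"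
  where "nondegenerate_lightlike_in g x \<longleftrightarrow>
    lightlike_in g x \<and> frechet_derivative (discriminant g) (at x) \<noteq> (\<lambda>_. 0)"


section \<open>Lightlike points of the first kind and the lightlike singular curvature\<close>

text \<open>Near \<open>x\<close> the lightlike set is the image of the regular curve \<open>\<gamma>\<close>, defined on the open
  interval from \<open>a\<close> to \<open>b\<close>.\<close>

definition LD_curve ::
  "(real^2 \<Rightarrow> real^3) \<Rightarrow> (real^2) set \<Rightarrow> real^2 \<Rightarrow> real \<Rightarrow> real \<Rightarrow> (real \<Rightarrow> real^2) \<Rightarrow> bool"
  where "LD_curve g D x a b \<gamma> \<longleftrightarrow>
    a < 0 \<and> 0 < b \<and> \<gamma> 0 = x \<and> smooth_on {a<..<b} \<gamma> \<and>
    (\<forall>t\<in>{a<..<b}. vector_derivative \<gamma> (at t) \<noteq> 0) \<and>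
    (\<exists>W. open W \<and> x \<in> W \<and> W \<subseteq> D \<and> \<gamma> ` {a<..<b} = LD_in g D \<inter> W)"

definition null_vector_field ::
  "(real^2 \<Rightarrow> real^3) \<Rightarrow> (real^2) set \<Rightarrow> (real^2) set \<Rightarrow> (real^2 \<Rightarrow> real^2) \<Rightarrow> bool"
  where "null_vector_field g D V \<eta> \<longleftrightarrow>
    open V \<and> V \<subseteq> D \<and> smooth_on V \<eta> \<and> (\<forall>q \<in> LD_in g D \<inter> V. null_vector g q (\<eta> q))"

text \<open>The directional derivative of \<open>\<langle>df(\<eta>), df(\<eta>)\<rangle>\<close> in the direction \<open>\<eta>\<close> is \<open>1\<close> along the
  lightlike set.\<close>

definition normalized_null_vector_field ::
  "(real^2 \<Rightarrow> real^3) \<Rightarrow> (real^2) set \<Rightarrow> (real^2) set \<Rightarrow> (real^2 \<Rightarrow> real^2) \<Rightarrow> bool"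
  where "normalized_null_vector_field g D V \<eta> \<longleftrightarrow>
    null_vector_field g D V \<eta> \<and>
    (\<forall>q \<in> LD_in g D \<inter> V.
       frechet_derivative (\<lambda>y. ds2 g y (\<eta> y) (\<eta> y)) (at q) (\<eta> q) = 1)"

definition first_kind_in :: "(real^2 \<Rightarrow> real^3) \<Rightarrow> (real^2) set \<Rightarrow> real^2 \<Rightarrow> bool"
  where "first_kind_in g D x \<longleftrightarrow>
    nondegenerate_lightlike_in g x \<and>
    (\<exists>a b \<gamma> V \<eta>. LD_curve g D x a b \<gamma> \<and> x \<in> V \<and> null_vector_field g D V \<eta> \<and>
       vector_derivative \<gamma> (at 0) \<noteq> \<eta> x \<and>
       independent {vector_derivative \<gamma> (at 0), \<eta> x})"

text \<open>The first-kind property does not depend on the chart, so requiring it in one chart at \<open>p\<close> is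
  the same as requiring it in all of them.\<close>

definition first_kind :: "'a chart set \<Rightarrow> ('a \<Rightarrow> real^3) \<Rightarrow> 'a \<Rightarrow> bool"
  where "first_kind A f p \<longleftrightarrow>
    (\<exists>c\<in>A. p \<in> fst c \<and> first_kind_in (coord_rep f c) (coord_dom c) (snd c p))"

text \<open>As the connection of the ambient space is flat, the covariant derivative of the velocity of
  \<open>g \<circ> \<gamma>\<close> is the ordinary second derivative.\<close>

definition is_lightlike_singular_curvature_in ::
  "(real^2 \<Rightarrow> real^3) \<Rightarrow> (real^2) set \<Rightarrow> real^2 \<Rightarrow> real \<Rightarrow> bool"
  where "is_lightlike_singular_curvature_in g D x k \<longleftrightarrow>
    (\<exists>a b \<gamma> V \<eta>. LD_curve g D x a b \<gamma> \<and>
       (\<forall>t\<in>{a<..<b}. lorentz_norm (vector_derivative (g \<circ> \<gamma>) (at t)) = 1) \<and>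
       x \<in> V \<and> normalized_null_vector_field g D V \<eta> \<and>
       k = lorentz (vector_derivative (\<lambda>t. vector_derivative (g \<circ> \<gamma>) (at t)) (at 0))
                   (tangent_map g (\<gamma> 0) (\<eta> (\<gamma> 0))))"

text \<open>At a point of the first kind the value is independent of the chart, of the orientation of the
  curve and of the normalized null vector field, so the description is definite.\<close>

definition lightlike_singular_curvature :: "'a chart set \<Rightarrow> ('a \<Rightarrow> real^3) \<Rightarrow> 'a \<Rightarrow> real"
  where "lightlike_singular_curvature A f p =
    (THE k. \<exists>c\<in>A. p \<in> fst c \<and>
       is_lightlike_singular_curvature_in (coord_rep f c) (coord_dom c) (snd c p) k)"


section \<open>Euclidean shape of the image\<close>

text \<open>From here on \<open>real^3\<close> carries its Euclidean inner product.\<close>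

definition partial :: "2 \<Rightarrow> (real^2 \<Rightarrow> real^3) \<Rightarrow> real^2 \<Rightarrow> real^3"
  where "partial i g x = frechet_derivative g (at x) (axis i 1)"

definition unit_normal :: "(real^2 \<Rightarrow> real^3) \<Rightarrow> real^2 \<Rightarrow> real^3"
  where "unit_normal g x = sgn (cross3 (partial 1 g x) (partial 2 g x))"

definition gauss_curvature_in :: "(real^2 \<Rightarrow> real^3) \<Rightarrow> real^2 \<Rightarrow> real"
  where "gauss_curvature_in g x =
    ((partial 1 (partial 1 g) x \<bullet> unit_normal g x) * (partial 2 (partial 2 g) x \<bullet> unit_normal g x)
       - (partial 1 (partial 2 g) x \<bullet> unit_normal g x)\<^sup>2)
    / ((partial 1 g x \<bullet> partial 1 g x) * (partial 2 g x \<bullet> partial 2 g x)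
       - (partial 1 g x \<bullet> partial 2 g x)\<^sup>2)"

definition saddle_shaped_near ::
  "'a topology \<Rightarrow> 'a chart set \<Rightarrow> ('a \<Rightarrow> real^3) \<Rightarrow> 'a \<Rightarrow> bool"
  where "saddle_shaped_near X A f p \<longleftrightarrow>
    (\<exists>W. openin X W \<and> p \<in> W \<and>
       (\<forall>q\<in>W. \<forall>c\<in>A. q \<in> fst c \<longrightarrow> gauss_curvature_in (coord_rep f c) (snd c q) < 0))"

definition affine_tangent_plane_in :: "(real^2 \<Rightarrow> real^3) \<Rightarrow> real^2 \<Rightarrow> (real^3) set"
  where "affine_tangent_plane_in g x = range (\<lambda>v. g x + tangent_map g x v)"

text \<open>Both sides are covered, since the normal \<open>n\<close> may be replaced by \<open>- n\<close>.\<close>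

definition on_one_side :: "(real^3) set \<Rightarrow> (real^3) set \<Rightarrow> bool"
  where "on_one_side S P \<longleftrightarrow>
    (\<exists>n d. n \<noteq> 0 \<and> P = {y. n \<bullet> y = d} \<and> S \<subseteq> {y. n \<bullet> y \<ge> d})"

definition one_sided_at ::
  "'a topology \<Rightarrow> 'a chart set \<Rightarrow> ('a \<Rightarrow> real^3) \<Rightarrow> 'a \<Rightarrow> bool"
  where "one_sided_at X A f q \<longleftrightarrow>
    (\<exists>W. openin X W \<and> q \<in> W \<and>
       (\<forall>c\<in>A. q \<in> fst c \<longrightarrow>
          on_one_side (f ` W) (affine_tangent_plane_in (coord_rep f c) (snd c q))))"

text \<open>At every point near \<open>p\<close>, in particular at \<open>p\<close> itself, the image lies locally on one side of the
  affine tangent plane at that point.\<close>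

definition locally_convex_near ::
  "'a topology \<Rightarrow> 'a chart set \<Rightarrow> ('a \<Rightarrow> real^3) \<Rightarrow> 'a \<Rightarrow> bool"
  where "locally_convex_near X A f p \<longleftrightarrow>
    (\<exists>W. openin X W \<and> p \<in> W \<and> (\<forall>q\<in>W. one_sided_at X A f q))"

end

theory Submission
  imports Defs
begin

text \<open>Let \<open>w\<close> be a null vector at the lightlike point and \<open>L = df(w)\<close>. Since \<open>w\<close> is null, \<open>L\<close> is
  Lorentz orthogonal to the tangent plane, so \<open>\<langle>\<cdot>, L\<rangle>\<close> annihilates it. Hence \<open>\<langle>\<cdot>, L\<rangle>\<close> is also the
  Euclidean product with a Euclidean normal vector (the reflection of \<open>L\<close> in the horizontal plane),
  and \<open>B(a, b) = \<langle>D\<^sup>2f(a, b), L\<rangle>\<close> is a nonzero multiple of the Euclidean second fundamental form. The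
  sign of the Gaussian curvature is the sign of the determinant of \<open>B\<close>, in whichever frame it is
  computed.

  Take the frame \<open>v = \<gamma>'(0)\<close>, \<open>w = \<eta>\<close>, where \<open>\<gamma>\<close> is the unit speed lightlike curve and \<open>\<eta>\<close> the
  normalized null field. Terms of the form \<open>\<langle>df(a), L\<rangle>\<close> vanish, so the normalization of \<open>\<eta>\<close> reads
  \<open>B(w, w) = 1/2\<close>, differentiating \<open>\<langle>df(\<eta>), df(\<eta>)\<rangle> = 0\<close> along \<open>\<gamma>\<close> gives \<open>B(v, w) = 0\<close>, and the lightlike
  singular curvature is \<open>\<kappa> = B(v, v)\<close> (lemma \<open>lightlike_singular_curvature_frame\<close>). So the
  determinant is \<open>\<kappa>/2\<close>, and the Gaussian curvature at the point has the sign of \<open>\<kappa>\<close>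
  (\<open>first_kind_frame_gauss_curvature\<close>). By continuity it keeps this sign nearby. Negative curvature is
  the saddle shape; where it is positive, the second fundamental form is definite, and the height over
  a tangent plane is convex on segments starting at the point of tangency
  (\<open>convex_near_positive_gauss_curvature\<close>).

  The number \<open>\<kappa>\<close> is given by a definite description, so its existence and uniqueness are part of the
  argument. Uniqueness: that \<open>w\<close> is null, that \<open>B(w, w) = 1/2\<close>, \<open>B(v, w) = 0\<close> and \<open>ds\<^sup>2(v, v) = 1\<close>
  determine \<open>w\<close> completely and \<open>v\<close> up to sign, and these conditions survive a change of charts.
      Existence
  (\<open>lightlike_singular_curvature_exists\<close>): an arbitrary null field is rescaled by a cube root to a
  normalized one, and an arbitrary lightlike curve, which is spacelike because it is transversal to
  the null direction, is parametrized by arc length. Both steps use that the discriminant has nonzero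
  derivative in the null direction; this also makes short arcs of the curve fill out the lightlike set
  near the point (\<open>LD_curve_restrict\<close>).\<close>

section \<open>Calculus of smooth maps\<close>

lemma Ck_on_subset: "Ck_on k S f \<Longrightarrow> T \<subseteq> S \<Longrightarrow> Ck_on k T f"
proof (induction k arbitrary: f)
  case 0
  then show ?case by (auto intro: continuous_on_subset)
next
  case (Suc k)
  then show ?case by auto
qed

lemma Ck_on_Suc_lower: "Ck_on (Suc k) S f \<Longrightarrow> Ck_on k S f"
proof (induction k arbitrary: f)
  case 0
  then show ?case
    by (auto intro!: differentiable_imp_continuous_on differentiable_at_imp_differentiable_on)
next
  case (Suc k)
  have d: "\<forall>x\<in>S. f differentiable (at x)"
    and "\<And>b. b \<in> Basis \<Longrightarrow> Ck_on (Suc k) S (\<lambda>x. frechet_derivative f (at x) b)"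
    using Suc.prems unfolding Ck_on.simps(2)[of "Suc k"] by blast+
  from Suc.IH[OF this(2)] d show ?case unfolding Ck_on.simps(2)[of k] by blast
qed

lemma Ck_on_cong:
  assumes "open S" "\<And>x. x \<in> S \<Longrightarrow> f x = g x" "Ck_on k S f"
  shows "Ck_on k S g"
  using assms(2,3)
proof (induction k arbitrary: f g)
  case 0
  then show ?case by (simp cong: continuous_on_cong)
next
  case (Suc k)
  have d: "g differentiable (at x) \<and> frechet_derivative f (at x) = frechet_derivative g (at x)"
    if "x \<in> S" for x
  proof
    have "f differentiable (at x)" using Suc.prems that by simp
    then show "frechet_derivative f (at x) = frechet_derivative g (at x)"
      using frechet_derivative_transform_within_open[of f x S g] Suc.prems(1) assms(1) that by blast
    have "(f has_derivative frechet_derivative f (at x)) (at x)"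
      using \<open>f differentiable (at x)\<close> by (simp add: frechet_derivative_works)
    then have "(g has_derivative frechet_derivative f (at x)) (at x)"
      using has_derivative_transform_within_open[OF _ assms(1) that] Suc.prems(1) by blast
    then show "g differentiable (at x)" by (auto simp: differentiable_def)
  qed
  show ?case
  proof (simp, intro conjI ballI)
    fix x assume "x \<in> S" then show "g differentiable (at x)" using d by simp
  next
    fix b :: 'a assume b: "b \<in> Basis"
    have "Ck_on k S (\<lambda>x. frechet_derivative f (at x) b)" using Suc.prems b by simp
    then show "Ck_on k S (\<lambda>x. frechet_derivative g (at x) b)"
      by (rule Suc.IH[rotated]) (use d in simp)
  qed
qed

text \<open>The induction step of the closure properties: one may work with any explicit formula for the
  derivative instead of \<open>frechet_derivative\<close>.\<close>

lemma Ck_on_SucI: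
  assumes "open S" "\<And>x. x \<in> S \<Longrightarrow> (f has_derivative f' x) (at x)"
    and "\<And>b. b \<in> Basis \<Longrightarrow> Ck_on k S (\<lambda>x. f' x b)"
  shows "Ck_on (Suc k) S f"
proof (simp, intro conjI ballI)
  fix x assume "x \<in> S" then show "f differentiable (at x)"
    using assms(2) by (auto simp: differentiable_def)
next
  fix b :: 'a assume "b \<in> Basis"
  from assms(3)[OF this] show "Ck_on k S (\<lambda>x. frechet_derivative f (at x) b)"
    by (rule Ck_on_cong[OF assms(1), rotated]) (metis assms(2) frechet_derivative_at)
qed

lemma Ck_on_const [simp]: "open S \<Longrightarrow> Ck_on k S (\<lambda>x. c)"
  by (induction k arbitrary: c) auto

lemma Ck_on_has_derivative:
  "Ck_on (Suc k) S f \<Longrightarrow> x \<in> S \<Longrightarrow> (f has_derivative frechet_derivative f (at x)) (at x)"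
  by (simp add: frechet_derivative_works)

lemma Ck_on_bounded_linear:
  assumes "bounded_linear L" "open S" "Ck_on k S f"
  shows "Ck_on k S (\<lambda>x. L (f x))"
  using assms(3)
proof (induction k arbitrary: f)
  case 0
  then show ?case by (simp add: bounded_linear.continuous_on[OF assms(1)])
next
  case (Suc k)
  show ?case
  proof (rule Ck_on_SucI[OF assms(2)])
    show "((\<lambda>x. L (f x)) has_derivative (\<lambda>v. L (frechet_derivative f (at x) v))) (at x)" 
      if "x \<in> S" for x
      using bounded_linear.has_derivative[OF assms(1) Ck_on_has_derivative[OF Suc.prems that]] .
    show "Ck_on k S (\<lambda>x. L (frechet_derivative f (at x) b))" if "b \<in> Basis" for b
      using Suc that by simp
  qed
qed

lemma Ck_on_add:
  assumes "open S" "Ck_on k S f" "Ck_on k S g"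
  shows "Ck_on k S (\<lambda>x. f x + g x)"
  using assms(2,3)
proof (induction k arbitrary: f g)
  case 0
  then show ?case by (simp add: continuous_on_add)
next
  case (Suc k)
  show ?case
  proof (rule Ck_on_SucI[OF assms(1)])
    show "((\<lambda>x. f x + g x) has_derivative
       (\<lambda>v. frechet_derivative f (at x) v + frechet_derivative g (at x) v)) (at x)" 
      if "x \<in> S" for x
      by (intro has_derivative_add Ck_on_has_derivative[OF Suc.prems(1) that]
          Ck_on_has_derivative[OF Suc.prems(2) that])
    show "Ck_on k S (\<lambda>x. frechet_derivative f (at x) b + frechet_derivative g (at x) b)" 
      if "b \<in> Basis" for b
      using Suc that by simp
  qed
qed

lemma Ck_on_sum:
  assumes "open S" "\<And>i. i \<in> I \<Longrightarrow> Ck_on k S (f i)"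
  shows "Ck_on k S (\<lambda>x. \<Sum>i\<in>I. f i x)"
  using assms(2)
  by (induction I rule: infinite_finite_induct) (simp_all add: assms(1) Ck_on_add)

lemma Ck_on_bilinear:
  assumes B: "bounded_bilinear B" and "open S" "Ck_on k S f" "Ck_on k S g"
  shows "Ck_on k S (\<lambda>x. B (f x) (g x))"
  using assms(3,4)
proof (induction k arbitrary: f g)
  case 0
  then show ?case by (simp add: bounded_bilinear.continuous_on[OF B])
next
  case (Suc k)
  show ?case
  proof (rule Ck_on_SucI[OF assms(2)])
    show "((\<lambda>x. B (f x) (g x)) has_derivative
       (\<lambda>v. B (f x) (frechet_derivative g (at x) v) + B (frechet_derivative f (at x) v) (g x)))
           (at x)" 
      if "x \<in> S" for x
      by (intro bounded_bilinear.FDERIV[OF B] Ck_on_has_derivative[OF Suc.prems(1) that]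
          Ck_on_has_derivative[OF Suc.prems(2) that])
    show "Ck_on k S (\<lambda>x. B (f x) (frechet_derivative g (at x) b) + B (frechet_derivative f (at x)
        b) (g x))" 
      if "b \<in> Basis" for b
      using Suc that Ck_on_Suc_lower[OF Suc.prems(1)] Ck_on_Suc_lower[OF Suc.prems(2)]
      by (intro Ck_on_add assms(2) Suc.IH) auto
  qed
qed

text \<open>Expanding the direction in the basis turns a derivative in a variable direction into finitely many
  derivatives in constant directions, which are the ones that \<open>Ck_on\<close> speaks of.\<close>

lemma linear_Basis_expansion:
  fixes f :: "'a::euclidean_space \<Rightarrow> 'b::real_normed_vector"
  assumes "linear f"
  shows "f v = (\<Sum>i\<in>Basis. (v \<bullet> i) *\<^sub>R f i)"
proof -
  have "f v = f (\<Sum>i\<in>Basis. (v \<bullet> i) *\<^sub>R i)" by (simp add: euclidean_representation)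
  also have "\<dots> = (\<Sum>i\<in>Basis. (v \<bullet> i) *\<^sub>R f i)"
    by (simp add: linear_sum[OF assms] linear_cmul[OF assms])
  finally show ?thesis .
qed

lemma Ck_on_frechet_apply:
  assumes "open S" "Ck_on (Suc k) S f" "Ck_on k S \<eta>"
  shows "Ck_on k S (\<lambda>x. frechet_derivative f (at x) (\<eta> x))"
proof (rule Ck_on_cong[OF assms(1)])
  show "(\<Sum>i\<in>Basis. (\<eta> x \<bullet> i) *\<^sub>R frechet_derivative f (at x) i) =
      frechet_derivative f (at x) (\<eta> x)" if "x \<in> S" for x
    by (rule linear_Basis_expansion[symmetric]) (use assms that in \<open>auto intro:
        linear_frechet_derivative\<close>)
  show "Ck_on k S (\<lambda>x. \<Sum>i\<in>Basis. (\<eta> x \<bullet> i) *\<^sub>R frechet_derivative f (at x) i)"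
    using assms 
    by (intro Ck_on_sum Ck_on_bilinear[OF bounded_bilinear_scaleR]
        Ck_on_bounded_linear[OF bounded_linear_inner_left]) auto
qed

text \<open>By the chain rule the derivative of the composition is a sum of products of \<open>C\<^sup>k\<close> functions, one
  factor of which is again a composition, with a derivative of \<open>g\<close>; so the induction is over all \<open>g\<close>.\<close>

lemma Ck_on_compose:
  assumes "open S" "open T" "f ` S \<subseteq> T" "Ck_on k S f" "Ck_on k T g"
  shows "Ck_on k S (\<lambda>x. g (f x))"
  using assms(4,5)
proof (induction k arbitrary: g)
  case 0
  then show ?case using continuous_on_compose2[of T g S f] assms(3) by simp
next
  case (Suc k)
  show ?case
  proof (rule Ck_on_SucI[OF assms(1)])
    fix x assume x: "x \<in> S"
    then have "f x \<in> T" using assms(3) by auto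
    from has_derivative_compose[OF Ck_on_has_derivative[OF Suc.prems(1) x]
        Ck_on_has_derivative[OF Suc.prems(2) this]]
    show "((\<lambda>x. g (f x)) has_derivative
       (\<lambda>v. frechet_derivative g (at (f x)) (frechet_derivative f (at x) v))) (at x)" .
  next
    fix b :: 'a assume b: "b \<in> Basis"
    show "Ck_on k S (\<lambda>x. frechet_derivative g (at (f x)) (frechet_derivative f (at x) b))"
    proof (rule Ck_on_cong[OF assms(1)])
      show "(\<Sum>i\<in>Basis. (frechet_derivative f (at x) b \<bullet> i) *\<^sub>R frechet_derivative g (at (f x)) i) =
          frechet_derivative g (at (f x)) (frechet_derivative f (at x) b)" if "x \<in> S" for x
        using assms(3) that
        by (intro linear_Basis_expansion[symmetric]
            has_derivative_linear[OF Ck_on_has_derivative[OF Suc.prems(2)]]) auto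
      have "Ck_on k S (\<lambda>x. frechet_derivative g (at (f x)) i)" if "i \<in> Basis" for i
        using Suc.IH[OF Ck_on_Suc_lower[OF Suc.prems(1)], of "\<lambda>y. frechet_derivative g (at y) i"]
          Suc.prems(2) that by simp
      then show "Ck_on k S (\<lambda>x. \<Sum>i\<in>Basis. (frechet_derivative f (at x) b \<bullet> i) *\<^sub>R
                    frechet_derivative g (at (f x)) i)"
        using Suc.prems(1) b assms(1)
        by (intro Ck_on_sum Ck_on_bilinear[OF bounded_bilinear_scaleR]
            Ck_on_bounded_linear[OF bounded_linear_inner_left]) auto
    qed
  qed
qed

text \<open>Differentiation only changes the exponent and a constant factor, so all exponents are treated at
  once.\<close>

lemma Ck_on_powr: "Ck_on k {0<..} (\<lambda>x::real. x powr a)"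
proof (induction k arbitrary: a)
  case 0
  then show ?case by (auto intro!: continuous_intros)
next
  case (Suc k)
  show ?case
  proof (rule Ck_on_SucI[OF open_greaterThan])
    fix x :: real assume "x \<in> {0<..}"
    then have "((\<lambda>x. x powr a) has_real_derivative a * x powr (a - 1)) (at x)"
      by (auto intro: has_real_derivative_powr)
    then show "((\<lambda>x. x powr a) has_derivative (\<lambda>v. (a * x powr (a - 1)) * v)) (at x)"
      by (simp add: has_field_derivative_def)
  next
    fix b :: real assume "b \<in> Basis"
    then have [simp]: "b = 1" by simp
    show "Ck_on k {0<..} (\<lambda>x. a * x powr (a - 1) * b)"
      using Ck_on_bounded_linear[OF bounded_linear_mult_right[of a] open_greaterThan Suc.IH[of "a
          - 1"]]
      by simp
  qed
qed

lemma smooth_on_subset: "smooth_on S f \<Longrightarrow> T \<subseteq> S \<Longrightarrow> smooth_on T f"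
  unfolding smooth_on_def by (blast intro: Ck_on_subset)

lemma smooth_on_const: "open S \<Longrightarrow> smooth_on S (\<lambda>x. c)"
  by (simp add: smooth_on_def)

lemma smooth_on_bounded_linear:
  "bounded_linear L \<Longrightarrow> open S \<Longrightarrow> smooth_on S f \<Longrightarrow> smooth_on S (\<lambda>x. L (f x))"
  by (simp add: smooth_on_def Ck_on_bounded_linear)

lemma smooth_on_bilinear:
  "bounded_bilinear B \<Longrightarrow> open S \<Longrightarrow> smooth_on S f \<Longrightarrow> smooth_on S g \<Longrightarrow>
    smooth_on S (\<lambda>x. B (f x) (g x))"
  by (simp add: smooth_on_def Ck_on_bilinear)

lemma smooth_on_frechet_apply:
  "open S \<Longrightarrow> smooth_on S f \<Longrightarrow> smooth_on S \<eta> \<Longrightarrow>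
    smooth_on S (\<lambda>x. frechet_derivative f (at x) (\<eta> x))"
  by (auto simp: smooth_on_def simp del: Ck_on.simps intro!: Ck_on_frechet_apply)

lemma smooth_on_compose:
  "open S \<Longrightarrow> open T \<Longrightarrow> f ` S \<subseteq> T \<Longrightarrow> smooth_on S f \<Longrightarrow> smooth_on T g \<Longrightarrow>
    smooth_on S (\<lambda>x. g (f x))"
  by (auto simp: smooth_on_def simp del: Ck_on.simps intro: Ck_on_compose)

lemma smooth_on_powr:
  fixes f :: "'a::euclidean_space \<Rightarrow> real"
  assumes "open S" "smooth_on S f" "\<And>x. x \<in> S \<Longrightarrow> f x > 0"
  shows "smooth_on S (\<lambda>x. f x powr a)"
proof (rule smooth_on_compose[where T = "{0<..}" and g = "\<lambda>y. y powr a"])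
  show "smooth_on {0<..} (\<lambda>y::real. y powr a)" by (simp add: smooth_on_def Ck_on_powr)
qed (use assms in auto)

lemma smooth_on_has_derivative:
  "smooth_on S f \<Longrightarrow> x \<in> S \<Longrightarrow> (f has_derivative frechet_derivative f (at x)) (at x)"
  unfolding smooth_on_def using Ck_on_has_derivative by blast

lemma smooth_on_linear:
  "smooth_on S f \<Longrightarrow> x \<in> S \<Longrightarrow> linear (frechet_derivative f (at x))"
  by (rule has_derivative_linear[OF smooth_on_has_derivative])

lemma smooth_on_continuous_on: "smooth_on S f \<Longrightarrow> continuous_on S f"
  unfolding smooth_on_def by (metis Ck_on.simps(1))

lemma smooth_on_cong:
  "open S \<Longrightarrow> (\<And>x. x \<in> S \<Longrightarrow> f x = g x) \<Longrightarrow> smooth_on S f \<Longrightarrow> smooth_on S g"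
  unfolding smooth_on_def using Ck_on_cong by blast

section \<open>Second derivatives\<close>

definition second_derivative ::
  "('a::euclidean_space \<Rightarrow> 'b::real_normed_vector) \<Rightarrow> 'a \<Rightarrow> 'a \<Rightarrow> 'a \<Rightarrow> 'b"
  where "second_derivative g x v w =
    frechet_derivative (\<lambda>y. frechet_derivative g (at y) w) (at x) v"

lemma smooth_on_frechet_const:
  "open S \<Longrightarrow> smooth_on S f \<Longrightarrow> smooth_on S (\<lambda>x. frechet_derivative f (at x) v)"
  by (rule smooth_on_frechet_apply) (auto simp: smooth_on_const)

lemma smooth_on_second_derivative:
  "open S \<Longrightarrow> smooth_on S f \<Longrightarrow> smooth_on S (\<lambda>x. second_derivative f x v w)"
  unfolding second_derivative_def by (intro smooth_on_frechet_const)

text \<open>The product rule for a derivative taken at a moving point in a moving direction. Stated in the basis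
  first,
  because the case of a constant direction is what shows that the second derivative is linear in its
  last argument.\<close>

lemma has_derivative_frechet_apply_Basis:
  fixes g :: "'a::euclidean_space \<Rightarrow> 'b::real_normed_vector"
  assumes D: "open D" "smooth_on D g" "F a \<in> D"
    and F: "(F has_derivative F') (at a)" and Z: "(Z has_derivative Z') (at a)"
  shows "((\<lambda>s. frechet_derivative g (at (F s)) (Z s)) has_derivative
    (\<lambda>h. (\<Sum>i\<in>Basis. (Z a \<bullet> i) *\<^sub>R second_derivative g (F a) (F' h) i)
      + frechet_derivative g (at (F a)) (Z' h))) (at a)"
proof -
  have ev: "\<forall>\<^sub>F s in at a. (\<Sum>i\<in>Basis. (Z s \<bullet> i) *\<^sub>R frechet_derivative g (at (F s)) i) =
      frechet_derivative g (at (F s)) (Z s)"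
  proof -
    have "\<forall>\<^sub>F s in at a. F s \<in> D"
      using has_derivative_continuous[OF F] D by (auto simp: continuous_within intro:
          topological_tendstoD)
    then show ?thesis
      by eventually_elim (rule linear_Basis_expansion[symmetric], rule smooth_on_linear[OF D(2)])
  qed
  have d1: "((\<lambda>s. frechet_derivative g (at (F s)) i) has_derivative
      (\<lambda>h. second_derivative g (F a) (F' h) i)) (at a)" for i
    using has_derivative_compose[OF F smooth_on_has_derivative[OF smooth_on_frechet_const[OF
        D(1,2)] D(3)]]
    unfolding second_derivative_def .
  have "((\<lambda>s. \<Sum>i\<in>Basis. (Z s \<bullet> i) *\<^sub>R frechet_derivative g (at (F s)) i) has_derivative
    (\<lambda>h. \<Sum>i\<in>Basis. (Z a \<bullet> i) *\<^sub>R second_derivative g (F a) (F' h) i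
      + (Z' h \<bullet> i) *\<^sub>R frechet_derivative g (at (F a)) i)) (at a)"
    by (intro has_derivative_sum has_derivative_scaleR d1 has_derivative_inner_left Z)
  moreover have "(\<Sum>i\<in>Basis. (Z' h \<bullet> i) *\<^sub>R frechet_derivative g (at (F a)) i) =
      frechet_derivative g (at (F a)) (Z' h)" for h
    by (rule linear_Basis_expansion[symmetric], rule smooth_on_linear[OF D(2,3)])
  moreover have "(\<Sum>i\<in>Basis. (Z a \<bullet> i) *\<^sub>R frechet_derivative g (at (F a)) i) =
      frechet_derivative g (at (F a)) (Z a)"
    by (rule linear_Basis_expansion[symmetric], rule smooth_on_linear[OF D(2,3)])
  ultimately show ?thesis
    using has_derivative_transform_eventually[OF _ ev] by (simp add: sum.distrib)
qed

lemma second_derivative_Basis: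
  fixes g :: "'a::euclidean_space \<Rightarrow> 'b::real_normed_vector"
  assumes "open D" "smooth_on D g" "x \<in> D"
  shows "second_derivative g x v w = (\<Sum>i\<in>Basis. (w \<bullet> i) *\<^sub>R second_derivative g x v i)"
proof -
  have l: "linear (frechet_derivative g (at x))" using assms smooth_on_linear by blast
  have "((\<lambda>y. frechet_derivative g (at y) w) has_derivative
     (\<lambda>v. \<Sum>i\<in>Basis. (w \<bullet> i) *\<^sub>R second_derivative g x v i)) (at x)"
    using has_derivative_frechet_apply_Basis[OF assms(1,2), of "\<lambda>y. y" x "\<lambda>y. y" "\<lambda>_. w" "\<lambda>_. 0"]
        assms(3)
    by (simp add: linear_0[OF l])
  from frechet_derivative_at[OF this] show ?thesis
    unfolding second_derivative_def[of g x v w] by metis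
qed

lemma has_derivative_frechet_apply:
  fixes g :: "'a::euclidean_space \<Rightarrow> 'b::real_normed_vector"
  assumes "open D" "smooth_on D g" "F a \<in> D"
    and "(F has_derivative F') (at a)" "(Z has_derivative Z') (at a)"
  shows "((\<lambda>s. frechet_derivative g (at (F s)) (Z s)) has_derivative
    (\<lambda>h. second_derivative g (F a) (F' h) (Z a) + frechet_derivative g (at (F a)) (Z' h))) (at a)"
  using has_derivative_frechet_apply_Basis[OF assms]
  unfolding second_derivative_Basis[OF assms(1-3), where w = "Z a", symmetric] .

lemma second_derivative_linear:
  fixes g :: "'a::euclidean_space \<Rightarrow> 'b::real_normed_vector"
  assumes "open D" "smooth_on D g" "x \<in> D"
  shows "linear (\<lambda>v. second_derivative g x v w)" "linear (second_derivative g x v)"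
proof -
  show "linear (\<lambda>v. second_derivative g x v w)"
    using smooth_on_linear[OF smooth_on_frechet_const[OF assms(1,2)] assms(3)]
    unfolding second_derivative_def .
  show "linear (second_derivative g x v)"
  proof (rule linearI)
    fix a b and c :: real
    show "second_derivative g x v (a + b) = second_derivative g x v a + second_derivative g x v b"
      by (subst (1 2 3) second_derivative_Basis[OF assms])
         (simp add: inner_add_left scaleR_add_left sum.distrib)
    show "second_derivative g x v (c *\<^sub>R a) = c *\<^sub>R second_derivative g x v a"
      by (subst (1 2) second_derivative_Basis[OF assms])
         (simp add: scaleR_sum_right)
  qed
qed

text \<open>The symmetric second difference divided by \<open>s\<^sup>2\<close> is a value of one mixed derivative, by two
  applications of the mean value theorem. Exchanging \<open>v\<close> and \<open>w\<close> leaves the difference unchanged but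
  yields the other mixed derivative, which forces the two to agree in the limit.\<close>

lemma mixed_difference_mean_value:
  fixes F :: "'a::euclidean_space \<Rightarrow> real"
  assumes D: "open D" "smooth_on D F" and s: "0 < s"
    and sub: "\<And>a b. a \<in> {0..s} \<Longrightarrow> b \<in> {0..s} \<Longrightarrow> x + a *\<^sub>R v + b *\<^sub>R w \<in> D"
  obtains a b where "a \<in> {0..s}" "b \<in> {0..s}"
    "F (x + s *\<^sub>R v + s *\<^sub>R w) - F (x + s *\<^sub>R v) - F (x + s *\<^sub>R w) + F x
      = s * s * second_derivative F (x + a *\<^sub>R v + b *\<^sub>R w) w v"
proof -
  define \<phi> where "\<phi> a = F (x + a *\<^sub>R v + s *\<^sub>R w) - F (x + a *\<^sub>R v + 0 *\<^sub>R w)" for a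
  have F1: "((\<lambda>a. F (x + a *\<^sub>R v + b *\<^sub>R w)) has_real_derivative
      frechet_derivative F (at (x + a *\<^sub>R v + b *\<^sub>R w)) v) (at a)"
    if "a \<in> {0..s}" "b \<in> {0..s}" for a b
  proof -
    have "((\<lambda>a. x + a *\<^sub>R v + b *\<^sub>R w) has_derivative (\<lambda>h. h *\<^sub>R v)) (at a)"
      by (auto intro!: derivative_eq_intros)
    from has_derivative_compose[OF this smooth_on_has_derivative[OF D(2) sub[OF that]]]
    show ?thesis
      using linear_cmul[OF smooth_on_linear[OF D(2) sub[OF that]]]
      unfolding has_field_derivative_def by (simp add: mult_commute_abs)
  qed
  have "(\<phi> has_real_derivative (frechet_derivative F (at (x + a *\<^sub>R v + s *\<^sub>R w)) v
       - frechet_derivative F (at (x + a *\<^sub>R v + 0 *\<^sub>R w)) v)) (at a)"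
    if "0 \<le> a" "a \<le> s" for a
    unfolding \<phi>_def using that s by (intro DERIV_diff F1) auto
  from MVT2[OF s this] obtain a where a: "0 < a" "a < s" and e1:
    "\<phi> s - \<phi> 0 = (s - 0) * (frechet_derivative F (at (x + a *\<^sub>R v + s *\<^sub>R w)) v
       - frechet_derivative F (at (x + a *\<^sub>R v + 0 *\<^sub>R w)) v)" by blast
  have F2: "((\<lambda>b. frechet_derivative F (at (x + a *\<^sub>R v + b *\<^sub>R w)) v) has_real_derivative
      second_derivative F (x + a *\<^sub>R v + b *\<^sub>R w) w v) (at b)"
    if "0 \<le> b" "b \<le> s" for b
  proof -
    have m: "x + a *\<^sub>R v + b *\<^sub>R w \<in> D" using sub a that by auto
    have "((\<lambda>b. x + a *\<^sub>R v + b *\<^sub>R w) has_derivative (\<lambda>h. h *\<^sub>R w)) (at b)"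
      by (auto intro!: derivative_eq_intros)
    from has_derivative_compose[OF this smooth_on_has_derivative[OF smooth_on_frechet_const[OF D] m]]
    show ?thesis
      using linear_cmul[OF second_derivative_linear(1)[OF D m]]
      unfolding has_field_derivative_def second_derivative_def by (simp add: mult_commute_abs)
  qed
  from MVT2[OF s F2] obtain b where b: "0 < b" "b < s" and e2:
    "frechet_derivative F (at (x + a *\<^sub>R v + s *\<^sub>R w)) v
       - frechet_derivative F (at (x + a *\<^sub>R v + 0 *\<^sub>R w)) v
     = (s - 0) * second_derivative F (x + a *\<^sub>R v + b *\<^sub>R w) w v" by blast
  show ?thesis
  proof (rule that[of a b])
    show "F (x + s *\<^sub>R v + s *\<^sub>R w) - F (x + s *\<^sub>R v) - F (x + s *\<^sub>R w) + F x
      = s * s * second_derivative F (x + a *\<^sub>R v + b *\<^sub>R w) w v"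
      using e1 e2 by (simp add: \<phi>_def)
  qed (use a b in auto)
qed

lemma second_derivative_commute_real:
  fixes F :: "'a::euclidean_space \<Rightarrow> real"
  assumes D: "open D" "smooth_on D F" and x: "x \<in> D"
  shows "second_derivative F x v w = second_derivative F x w v"
proof (rule ccontr)
  assume ne: "second_derivative F x v w \<noteq> second_derivative F x w v"
  \<comment> \<open>neighbourhoods of this radius around the two mixed derivatives are disjoint\<close>
  define e where "e = \<bar>second_derivative F x v w - second_derivative F x w v\<bar> / 2"
  have e: "e > 0" using ne by (simp add: e_def)
  have c: "continuous (at x) (\<lambda>y. second_derivative F y v w)" for v w
    using smooth_on_continuous_on[OF smooth_on_second_derivative[OF D]] x D(1)
      continuous_on_eq_continuous_at by blast
  obtain d1 where d1: "d1 > 0"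
    "\<And>y. dist y x < d1 \<Longrightarrow> dist (second_derivative F y v w) (second_derivative F x v w) < e"
    using c[of v w] e unfolding continuous_at_eps_delta by blast
  obtain d2 where d2: "d2 > 0"
    "\<And>y. dist y x < d2 \<Longrightarrow> dist (second_derivative F y w v) (second_derivative F x w v) < e"
    using c[of w v] e unfolding continuous_at_eps_delta by blast
  obtain d3 where d3: "d3 > 0" "ball x d3 \<subseteq> D"
    using D(1) x open_contains_ball by blast
  define d where "d = min d1 (min d2 d3)"
  have d: "d > 0" using d1 d2 d3 by (simp add: d_def)
  define m where "m = norm v + norm w + 1"
  \<comment> \<open>so small that the parallelogram spanned by \<open>s v\<close> and \<open>s w\<close> at \<open>x\<close> lies in the ball of radius \<open>d\<close>\<close>
  define s where "s = d / (2 * m)"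
  have n: "m > 0" by (simp add: m_def add_nonneg_pos)
  have s: "s > 0" unfolding s_def using d n by simp
  have near: "dist (x + a *\<^sub>R v + b *\<^sub>R w) x < d" if "a \<in> {0..s}" "b \<in> {0..s}" for a b
  proof -
    have "dist (x + a *\<^sub>R v + b *\<^sub>R w) x \<le> a * norm v + b * norm w"
      using norm_triangle_ineq[of "a *\<^sub>R v" "b *\<^sub>R w"] that by (simp add: dist_norm add.assoc)
    also have "\<dots> \<le> s * norm v + s * norm w"
      using that by (intro add_mono mult_right_mono) auto
    also have "\<dots> \<le> s * m" using s by (simp add: m_def algebra_simps)
    also have "\<dots> = d / 2" unfolding s_def using n by simp
    finally show ?thesis using d by linarith
  qed
  have sub: "x + a *\<^sub>R v + b *\<^sub>R w \<in> D" if "a \<in> {0..s}" "b \<in> {0..s}" for a b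
    using near[OF that] d3(2) by (auto simp: d_def dist_commute subset_iff)
  obtain a b where ab: "a \<in> {0..s}" "b \<in> {0..s}" 
    "F (x + s *\<^sub>R v + s *\<^sub>R w) - F (x + s *\<^sub>R v) - F (x + s *\<^sub>R w) + F x
      = s * s * second_derivative F (x + a *\<^sub>R v + b *\<^sub>R w) w v"
    using mixed_difference_mean_value[OF D s sub] .
  have sub': "x + a *\<^sub>R w + b *\<^sub>R v \<in> D" if "a \<in> {0..s}" "b \<in> {0..s}" for a b
    using sub[OF that(2,1)] by (simp add: ac_simps)
  obtain a' b' where ab': "a' \<in> {0..s}" "b' \<in> {0..s}" 
    "F (x + s *\<^sub>R w + s *\<^sub>R v) - F (x + s *\<^sub>R w) - F (x + s *\<^sub>R v) + F x
      = s * s * second_derivative F (x + a' *\<^sub>R w + b' *\<^sub>R v) v w"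
    using mixed_difference_mean_value[OF D s sub'] .
  have swap: "x + s *\<^sub>R w + s *\<^sub>R v = x + s *\<^sub>R v + s *\<^sub>R w" by (simp add: ac_simps)
  have "s * s * second_derivative F (x + a *\<^sub>R v + b *\<^sub>R w) w v
      = s * s * second_derivative F (x + a' *\<^sub>R w + b' *\<^sub>R v) v w"
    using ab(3) ab'(3) unfolding swap by linarith
  then have eq: "second_derivative F (x + a *\<^sub>R v + b *\<^sub>R w) w v
      = second_derivative F (x + a' *\<^sub>R w + b' *\<^sub>R v) v w"
    using s by simp
  have "dist (x + a' *\<^sub>R w + b' *\<^sub>R v) x < d" using near[OF ab'(2,1)] by (simp add: ac_simps)
  then have "dist (second_derivative F (x + a' *\<^sub>R w + b' *\<^sub>R v) v w) (second_derivative F x v w) < e"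
    using d1(2) by (simp add: d_def)
  moreover have "dist (second_derivative F (x + a *\<^sub>R v + b *\<^sub>R w) w v) (second_derivative F x w
      v) < e"
    using d2(2) near[OF ab(1,2)] by (simp add: d_def)
  ultimately have "dist (second_derivative F x v w) (second_derivative F x w v) < e + e"
    unfolding eq by (metis dist_triangle_less_add dist_commute)
  then show False by (simp add: e_def dist_real_def)
qed

lemma second_derivative_inner:
  fixes g :: "'a::euclidean_space \<Rightarrow> 'b::real_inner"
  assumes D: "open D" "smooth_on D g" and x: "x \<in> D"
  shows "frechet_derivative (\<lambda>y. g y \<bullet> n) (at x) v = frechet_derivative g (at x) v \<bullet> n"
    and "second_derivative (\<lambda>y. g y \<bullet> n) x v w = second_derivative g x v w \<bullet> n"
proof -
  have 1: "frechet_derivative (\<lambda>y. g y \<bullet> n) (at x) = (\<lambda>v. frechet_derivative g (at x) v \<bullet> n)"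
    if "x \<in> D" for x
    by (rule frechet_derivative_at[symmetric])
       (intro has_derivative_inner_left smooth_on_has_derivative[OF D(2) that])
  show "frechet_derivative (\<lambda>y. g y \<bullet> n) (at x) v = frechet_derivative g (at x) v \<bullet> n"
    using 1 x by simp
  have "((\<lambda>y. frechet_derivative g (at y) w \<bullet> n) has_derivative
      (\<lambda>v. second_derivative g x v w \<bullet> n)) (at x)"
    unfolding second_derivative_def
    by (intro has_derivative_inner_left smooth_on_has_derivative[OF smooth_on_frechet_const[OF D] x])
  from has_derivative_transform_within_open[OF this D(1) x, of "\<lambda>y. frechet_derivative (\<lambda>y. g y \<bullet>
      n) (at y) w"] 1
  have "((\<lambda>y. frechet_derivative (\<lambda>y. g y \<bullet> n) (at y) w) has_derivative
      (\<lambda>v. second_derivative g x v w \<bullet> n)) (at x)" by simp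
  from frechet_derivative_at[OF this] show "second_derivative (\<lambda>y. g y \<bullet> n) x v w =
      second_derivative g x v w \<bullet> n"
    unfolding second_derivative_def[of "\<lambda>y. g y \<bullet> n"] by metis
qed

text \<open>Reduction to real-valued functions by pairing with an arbitrary vector.\<close>

lemma second_derivative_commute:
  fixes g :: "'a::euclidean_space \<Rightarrow> 'b::real_inner"
  assumes D: "open D" "smooth_on D g" and x: "x \<in> D"
  shows "second_derivative g x v w = second_derivative g x w v"
proof -
  have "second_derivative g x v w \<bullet> n = second_derivative g x w v \<bullet> n" for n
    using second_derivative_commute_real[OF D(1) smooth_on_bounded_linear[OF
        bounded_linear_inner_left D] x]
    by (simp add: second_derivative_inner[OF D x])
  then show ?thesis by (metis inner_commute vector_eq_rdot)
qed

section \<open>Linear algebra of the plane and of Lorentz--Minkowski space\<close>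

definition det2 :: "real^2 \<Rightarrow> real^2 \<Rightarrow> real"
  where "det2 v w = v $ 1 * w $ 2 - v $ 2 * w $ 1"

lemma axis_expansion: "v = v $ 1 *\<^sub>R axis 1 1 + v $ 2 *\<^sub>R (axis 2 1 :: real^2)"
  by (simp add: vec_eq_iff forall_2 axis_def)

text \<open>Cramer's rule.\<close>

lemma det2_expansion:
  assumes "det2 v w \<noteq> 0"
  shows "u = (det2 u w / det2 v w) *\<^sub>R v + (det2 v u / det2 v w) *\<^sub>R w"
proof -
  have "det2 v w *\<^sub>R u = det2 u w *\<^sub>R v + det2 v u *\<^sub>R w"
    by (simp add: vec_eq_iff forall_2 det2_def algebra_simps)
  then have "(1 / det2 v w) *\<^sub>R (det2 v w *\<^sub>R u) = (1 / det2 v w) *\<^sub>R (det2 u w *\<^sub>R v + det2 v u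
      *\<^sub>R w)"
    by simp
  then show ?thesis using assms by (simp add: scaleR_add_right)
qed

lemma det2_zero:
  assumes "det2 v w = 0" "w \<noteq> 0"
  obtains c where "v = c *\<^sub>R w"
proof -
  have "w $ 1 \<noteq> 0 \<or> w $ 2 \<noteq> 0" using assms(2) by (simp add: vec_eq_iff forall_2)
  then show ?thesis
  proof
    assume "w $ 1 \<noteq> 0"
    then have "v = (v $ 1 / w $ 1) *\<^sub>R w"
      using assms(1) by (simp add: vec_eq_iff forall_2 det2_def field_simps)
    then show ?thesis using that by blast
  next
    assume "w $ 2 \<noteq> 0"
    then have "v = (v $ 2 / w $ 2) *\<^sub>R w"
      using assms(1) by (simp add: vec_eq_iff forall_2 det2_def field_simps)
    then show ?thesis using that by blast
  qed
qed

text \<open>Used both for the first fundamental form, where it computes the discriminant in another frame, and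
  for the second fundamental form, where it shows that the sign of the determinant does not depend on
  the frame.\<close>

lemma binary_form_discriminant:
  fixes B :: "real^2 \<Rightarrow> real^2 \<Rightarrow> real"
  assumes l: "\<And>w. linear (\<lambda>v. B v w)" "\<And>v. linear (B v)" and sym: "\<And>v w. B v w = B w v"
  shows "B v v * B w w - (B v w)\<^sup>2 =
    (det2 v w)\<^sup>2 * (B (axis 1 1) (axis 1 1) * B (axis 2 1) (axis 2 1) - (B (axis 1 1) (axis 2 1))\<^sup>2)"
proof -
  let ?e = "axis 1 1 :: real^2" and ?f = "axis 2 1 :: real^2"
  have e: "B v w = v $ 1 * w $ 1 * B ?e ?e + (v $ 1 * w $ 2 + v $ 2 * w $ 1) * B ?e ?f
      + v $ 2 * w $ 2 * B ?f ?f" for v w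
  proof -
    have 1: "B v u = v $ 1 * B ?e u + v $ 2 * B ?f u" for u
      by (subst axis_expansion[of v]) (simp only: linear_add[OF l(1)] linear_cmul[OF l(1)], simp)
    have 2: "B u w = w $ 1 * B u ?e + w $ 2 * B u ?f" for u
      by (subst axis_expansion[of w]) (simp only: linear_add[OF l(2)] linear_cmul[OF l(2)], simp)
    show ?thesis unfolding 1[of w] 2[of ?e] 2[of ?f] sym[of ?f ?e] by (simp add: algebra_simps)
  qed
  show ?thesis unfolding e[of v v] e[of w w] e[of v w] det2_def by (simp add: power2_eq_square
      algebra_simps)
qed

lemma bounded_bilinear_lorentz: "bounded_bilinear lorentz"
proof -
  have "bilinear lorentz"
    unfolding bilinear_def
    by (auto intro!: linearI simp: lorentz_def algebra_simps)
  then show ?thesis by (simp add: bilinear_conv_bounded_bilinear)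
qed

lemmas lorentz_bilinear_simps =
  bounded_bilinear.add_left[OF bounded_bilinear_lorentz]
  bounded_bilinear.add_right[OF bounded_bilinear_lorentz]
  bounded_bilinear.scaleR_left[OF bounded_bilinear_lorentz, simplified]
  bounded_bilinear.scaleR_right[OF bounded_bilinear_lorentz, simplified]
  bounded_bilinear.zero_left[OF bounded_bilinear_lorentz]
  bounded_bilinear.zero_right[OF bounded_bilinear_lorentz]
  bounded_bilinear.minus_left[OF bounded_bilinear_lorentz]
  bounded_bilinear.minus_right[OF bounded_bilinear_lorentz]

lemma lorentz_commute: "lorentz v w = lorentz w v"
  by (simp add: lorentz_def algebra_simps)

text \<open>The vector representing \<open>\<langle>\<cdot>, v\<rangle>\<close> in the Euclidean inner product; for a null tangent vector it is a
  Euclidean normal of the surface.\<close>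

definition lorentz_dual :: "real^3 \<Rightarrow> real^3"
  where "lorentz_dual v = vector [v $ 1, v $ 2, - v $ 3]"

lemma lorentz_dual_inner: "v \<bullet> lorentz_dual w = lorentz v w"
  by (simp add: lorentz_dual_def lorentz_def inner_vec_def sum_3)

lemma lorentz_dual_eq_0: "lorentz_dual v = 0 \<longleftrightarrow> v = 0"
  by (simp add: lorentz_dual_def vec_eq_iff forall_3)

text \<open>The lightlike plane with null direction \<open>L\<close> carries a semidefinite form: on it, \<open>L\<^sub>3\<^sup>2 \<langle>v, v\<rangle>\<close> is the
  square of a \<open>2 \<times> 2\<close> minor. This is what turns \<open>|\<langle>v, v\<rangle>| = 1\<close> into \<open>\<langle>v, v\<rangle> = 1\<close>.\<close>

lemma lorentz_nonneg_on_null_complement: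
  assumes L: "L \<noteq> 0" "lorentz L L = 0" and v: "lorentz v L = 0"
  shows "lorentz v v \<ge> 0"
proof -
  have 1: "L $ 3 * L $ 3 = L $ 1 * L $ 1 + L $ 2 * L $ 2"
    and 2: "v $ 3 * L $ 3 = v $ 1 * L $ 1 + v $ 2 * L $ 2"
    using L(2) v by (simp_all add: lorentz_def)
  have "(L $ 3)\<^sup>2 * lorentz v v = (L $ 3 * L $ 3) * (v $ 1 * v $ 1 + v $ 2 * v $ 2)
      - (v $ 3 * L $ 3) * (v $ 3 * L $ 3)"
    by (simp add: lorentz_def power2_eq_square algebra_simps)
  also have "\<dots> = (v $ 1 * L $ 2 - v $ 2 * L $ 1)\<^sup>2"
    unfolding 1 2 by (simp add: power2_eq_square algebra_simps)
  finally have "(L $ 3)\<^sup>2 * lorentz v v = (v $ 1 * L $ 2 - v $ 2 * L $ 1)\<^sup>2" .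
  moreover have "L $ 3 \<noteq> 0"
  proof
    assume "L $ 3 = 0"
    then have "(L $ 1)\<^sup>2 + (L $ 2)\<^sup>2 = 0" using L(2) by (simp add: lorentz_def power2_eq_square)
    then show False using L(1) \<open>L $ 3 = 0\<close> by (simp add: vec_eq_iff forall_3)
  qed
  ultimately have "0 \<le> (L $ 3)\<^sup>2 * lorentz v v" "L $ 3 \<noteq> 0" by simp_all
  then show ?thesis by (simp add: zero_le_mult_iff)
qed

lemma ds2_bilinear:
  assumes "linear (frechet_derivative g (at x))"
  shows "linear (\<lambda>v. ds2 g x v w)" "linear (ds2 g x v)"
proof -
  show "linear (\<lambda>v. ds2 g x v w)"
    by (rule linearI) (simp_all add: ds2_def linear_add[OF assms] linear_cmul[OF assms]
        lorentz_bilinear_simps)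
  show "linear (ds2 g x v)"
    by (rule linearI) (simp_all add: ds2_def linear_add[OF assms] linear_cmul[OF assms]
        lorentz_bilinear_simps)
qed

lemma ds2_commute: "ds2 g x v w = ds2 g x w v"
  by (simp add: ds2_def lorentz_commute)

section \<open>Euclidean normals of a surface\<close>

lemma cross_nonzero_if_inj:
  fixes T :: "real^2 \<Rightarrow> real^3"
  assumes "linear T" "inj T"
  shows "cross3 (T (axis 1 1)) (T (axis 2 1)) \<noteq> 0"
proof
  assume "cross3 (T (axis 1 1)) (T (axis 2 1)) = 0"
  then have "collinear {0, T (axis 1 1), T (axis 2 1)}" by (simp add: cross_eq_0)
  then consider "T (axis 1 1) = 0" | "T (axis 2 1) = 0" | c where "T (axis 2 1) = c *\<^sub>R T (axis 1 1)"
    by (auto simp: collinear_lemma)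
  then show False
  proof cases
    case 1
    then show False using linear_injective_0[OF assms(1)] assms(2) by auto
  next
    case 2
    then show False using linear_injective_0[OF assms(1)] assms(2) by auto
  next
    case 3
    then have "T (axis 2 1) = T (c *\<^sub>R axis 1 1)" by (simp add: linear_cmul[OF assms(1)])
    then have "axis 2 1 = c *\<^sub>R (axis 1 1 :: real^2)" using assms(2) by (simp add: inj_eq)
    then show False by (simp add: vec_eq_iff forall_2 axis_def)
  qed
qed

text \<open>From \<open>m \<times> (n \<times> m) = |m|\<^sup>2 n - (n \<bullet> m) m\<close> with \<open>m = a \<times> b\<close>, whose left hand side vanishes because
  \<open>n \<times> m\<close> is a combination of \<open>a\<close> and \<open>b\<close> with coefficients \<open>n \<bullet> b\<close> and \<open>n \<bullet> a\<close>.\<close>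

lemma normal_multiple_of_cross:
  fixes a b n :: "real^3"
  assumes "a \<bullet> n = 0" "b \<bullet> n = 0" "cross3 a b \<noteq> 0"
  obtains c where "n = c *\<^sub>R cross3 a b"
proof -
  have "(cross3 a b \<bullet> cross3 a b) *\<^sub>R n = (n \<bullet> cross3 a b) *\<^sub>R cross3 a b"
  proof -
    have "cross3 (cross3 a b) (cross3 n (cross3 a b)) = (cross3 a b \<bullet> cross3 a b) *\<^sub>R n - (n \<bullet>
        cross3 a b) *\<^sub>R cross3 a b"
      by (simp add: cross3_simps forall_3)
    moreover have "cross3 n (cross3 a b) = (n \<bullet> b) *\<^sub>R a - (n \<bullet> a) *\<^sub>R b"
      by (simp add: cross3_simps forall_3)
    ultimately show ?thesis using assms by (simp add: inner_commute)
  qed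
  then have "(1 / (cross3 a b \<bullet> cross3 a b)) *\<^sub>R ((cross3 a b \<bullet> cross3 a b) *\<^sub>R n)
      = (1 / (cross3 a b \<bullet> cross3 a b)) *\<^sub>R ((n \<bullet> cross3 a b) *\<^sub>R cross3 a b)" by simp
  then show ?thesis using assms(3) that by simp
qed

text \<open>The same identity gives \<open>|n|\<^sup>2 u = n \<times> (u \<times> n)\<close> for \<open>n = a \<times> b\<close>, and the triple products expand in
  \<open>a\<close> and \<open>b\<close>.\<close>

lemma span_if_orthogonal_cross:
  fixes a b u :: "real^3"
  assumes "u \<bullet> cross3 a b = 0" "cross3 a b \<noteq> 0"
  obtains c d where "u = c *\<^sub>R a + d *\<^sub>R b"
proof -
  define n where "n = cross3 a b"
  have nn: "n \<bullet> n \<noteq> 0" using assms(2) by (simp add: n_def)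
  have "(n \<bullet> n) *\<^sub>R u - (u \<bullet> n) *\<^sub>R n = (u \<bullet> b) *\<^sub>R cross3 n a - (u \<bullet> a) *\<^sub>R cross3 n b"
  proof -
    have "cross3 n (cross3 u n) = (n \<bullet> n) *\<^sub>R u - (u \<bullet> n) *\<^sub>R n"
      by (simp add: cross3_simps forall_3)
    moreover have "cross3 u n = (u \<bullet> b) *\<^sub>R a - (u \<bullet> a) *\<^sub>R b"
      unfolding n_def by (simp add: cross3_simps forall_3)
    ultimately show ?thesis by (metis Cross3.right_diff_distrib cross_mult_right)
  qed
  moreover have "cross3 n a = (a \<bullet> a) *\<^sub>R b - (a \<bullet> b) *\<^sub>R a"
    unfolding n_def by (simp add: cross3_simps forall_3)
  moreover have "cross3 n b = (a \<bullet> b) *\<^sub>R b - (b \<bullet> b) *\<^sub>R a"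
    unfolding n_def by (simp add: cross3_simps forall_3)
  moreover have "u \<bullet> n = 0" using assms(1) by (simp add: n_def)
  ultimately have "(n \<bullet> n) *\<^sub>R u = ((u \<bullet> a) * (b \<bullet> b) - (u \<bullet> b) * (a \<bullet> b)) *\<^sub>R a
      + ((u \<bullet> b) * (a \<bullet> a) - (u \<bullet> a) * (a \<bullet> b)) *\<^sub>R b"
    by (simp add: algebra_simps)
  then have "(1 / (n \<bullet> n)) *\<^sub>R ((n \<bullet> n) *\<^sub>R u) = (1 / (n \<bullet> n)) *\<^sub>R
     (((u \<bullet> a) * (b \<bullet> b) - (u \<bullet> b) * (a \<bullet> b)) *\<^sub>R a
      + ((u \<bullet> b) * (a \<bullet> a) - (u \<bullet> a) * (a \<bullet> b)) *\<^sub>R b)" by simp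
  then show ?thesis using nn that by (simp add: scaleR_add_right)
qed

lemma open_positive_set:
  fixes F :: "'a::topological_space \<Rightarrow> real"
  assumes "open D" "continuous_on D F"
  shows "open {z \<in> D. 0 < F z}"
proof -
  have "{z \<in> D. 0 < F z} = D \<inter> F -` {0<..}" by auto
  then show ?thesis using continuous_open_preimage[OF assms(2,1) open_greaterThan] by simp
qed

lemma sgn_square_mult: "c \<noteq> 0 \<Longrightarrow> sgn (c\<^sup>2 * a) = sgn (a::real)"
  using sgn_mult[of "c\<^sup>2" a] sgn_pos[of "c\<^sup>2"] by (simp only: zero_less_power2) simp

section \<open>The sign of the Gaussian curvature\<close>

text \<open>The determinant of the second fundamental form with respect to a normal vector \<open>n\<close> of arbitrary
  length.\<close>

definition hessian_det :: "(real^2 \<Rightarrow> real^3) \<Rightarrow> real^2 \<Rightarrow> real^3 \<Rightarrow> real"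
  where "hessian_det g x n =
    (second_derivative g x (axis 1 1) (axis 1 1) \<bullet> n) * (second_derivative g x (axis 2 1) (axis 2
        1) \<bullet> n)
      - (second_derivative g x (axis 1 1) (axis 2 1) \<bullet> n)\<^sup>2"

lemma hessian_det_scaleR: "hessian_det g x (c *\<^sub>R n) = c\<^sup>2 * hessian_det g x n"
  unfolding hessian_det_def inner_scaleR_right by (simp add: power2_eq_square algebra_simps)

lemma hessian_det_frame:
  assumes D: "open D" "smooth_on D g" "x \<in> D"
  shows "(second_derivative g x v v \<bullet> n) * (second_derivative g x w w \<bullet> n) - (second_derivative g
      x v w \<bullet> n)\<^sup>2
    = (det2 v w)\<^sup>2 * hessian_det g x n"
  unfolding hessian_det_def
proof (rule binary_form_discriminant[of "\<lambda>v w. second_derivative g x v w \<bullet> n"])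
  note l = second_derivative_linear[OF D]
  show "linear (\<lambda>v. second_derivative g x v w \<bullet> n)" "linear (\<lambda>w. second_derivative g x v w \<bullet> n)"
      for v w
    by (auto intro!: linearI simp: linear_add[OF l(1)] linear_cmul[OF l(1)]
        linear_add[OF l(2)] linear_cmul[OF l(2)] inner_add_left)
  show "second_derivative g x v w \<bullet> n = second_derivative g x w v \<bullet> n" for v w
    by (simp add: second_derivative_commute[OF D, of v w])
qed

lemma gauss_curvature_hessian_det:
  assumes "cross3 (partial 1 g x) (partial 2 g x) \<noteq> 0"
  shows "gauss_curvature_in g x = hessian_det g x (cross3 (partial 1 g x) (partial 2 g x))
    / (norm (cross3 (partial 1 g x) (partial 2 g x))) ^ 4"
proof -
  define n where "n = cross3 (partial 1 g x) (partial 2 g x)"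
  have 2: "partial i (partial j g) x = second_derivative g x (axis i 1) (axis j 1)" for i j
    by (simp add: partial_def[abs_def] second_derivative_def)
  have den: "(partial 1 g x \<bullet> partial 1 g x) * (partial 2 g x \<bullet> partial 2 g x)
       - (partial 1 g x \<bullet> partial 2 g x)\<^sup>2 = (norm n)\<^sup>2"
    using norm_cross_dot[of "partial 1 g x" "partial 2 g x"]
    by (simp add: n_def power_mult_distrib power2_norm_eq_inner)
  have "gauss_curvature_in g x = hessian_det g x (sgn n) / (norm n)\<^sup>2"
    by (simp add: gauss_curvature_in_def 2 den hessian_det_def unit_normal_def n_def)
  also have "\<dots> = hessian_det g x n / norm n ^ 4"
    by (simp add: sgn_div_norm hessian_det_scaleR power_inverse field_simps power2_eq_square
        numeral_eq_Suc)
  finally show ?thesis by (simp add: n_def)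
qed

text \<open>Normal vectors are unique up to scaling, and scaling multiplies the determinant by a positive
  square. So the normal may be chosen freely; here it will come from the null direction.\<close>

lemma sgn_gauss_curvature:
  assumes D: "open D" "smooth_on D g" "x \<in> D" and inj: "inj (frechet_derivative g (at x))"
    and n: "n \<noteq> 0" "\<And>v. frechet_derivative g (at x) v \<bullet> n = 0"
  shows "sgn (gauss_curvature_in g x) = sgn (hessian_det g x n)"
proof -
  define m where "m = cross3 (partial 1 g x) (partial 2 g x)"
  have m: "m \<noteq> 0"
    using cross_nonzero_if_inj[OF smooth_on_linear[OF D(2,3)] inj] by (simp add: m_def partial_def)
  obtain c where c: "n = c *\<^sub>R m"
    using normal_multiple_of_cross[of "partial 1 g x" n "partial 2 g x"] n(2) m
    unfolding m_def partial_def by auto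
  then have "c \<noteq> 0" using n(1) by auto
  then have "sgn (hessian_det g x n) = sgn (hessian_det g x m)"
    by (simp add: c hessian_det_scaleR sgn_square_mult)
  moreover have "sgn (gauss_curvature_in g x) = sgn (hessian_det g x m)"
    using gauss_curvature_hessian_det[of g x] m by (simp add: m_def sgn_divide)
  ultimately show ?thesis by simp
qed

lemma continuous_on_gauss_curvature:
  assumes D: "open D" "smooth_on D g" and inj: "\<And>x. x \<in> D \<Longrightarrow> inj (frechet_derivative g (at x))"
  shows "continuous_on D (gauss_curvature_in g)"
proof -
  let ?n = "\<lambda>x. cross3 (partial 1 g x) (partial 2 g x)"
  have n: "?n x \<noteq> 0" if "x \<in> D" for x
    using cross_nonzero_if_inj[OF smooth_on_linear[OF D(2) that] inj[OF that]] by (simp add: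
        partial_def)
  have p: "continuous_on D (\<lambda>x. partial i g x)" for i
    unfolding partial_def by (rule smooth_on_continuous_on[OF smooth_on_frechet_const[OF D]])
  have c: "continuous_on D (\<lambda>x. second_derivative g x v w)" for v w
    by (rule smooth_on_continuous_on[OF smooth_on_second_derivative[OF D]])
  have "continuous_on D (\<lambda>x. hessian_det g x (?n x) / norm (?n x) ^ 4)"
    unfolding hessian_det_def
    by (intro continuous_intros c continuous_on_cross p) (use n in auto)
  then show ?thesis
    by (rule continuous_on_eq) (use gauss_curvature_hessian_det n in auto)
qed

section \<open>Changes of coordinates\<close>

text \<open>The point \<open>x\<close> lies in the coordinate domain of \<open>g\<^sub>2\<close>, and \<open>\<phi>\<close> is the transition map to the coordinates of
  \<open>g\<^sub>1\<close>.\<close>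

locale coordinate_change =
  fixes g\<^sub>1 g\<^sub>2 :: "real^2 \<Rightarrow> real^3" and \<phi> :: "real^2 \<Rightarrow> real^2" and D S x
  assumes D: "open D" "smooth_on D g\<^sub>1"
    and S: "open S" "smooth_on S \<phi>" "\<phi> ` S \<subseteq> D" "\<And>y. y \<in> S \<Longrightarrow> g\<^sub>2 y = g\<^sub>1 (\<phi> y)" and x: "x \<in> S"
    and inj1: "inj (frechet_derivative g\<^sub>1 (at (\<phi> x)))"
    and inj: "inj (frechet_derivative g\<^sub>2 (at x))"
begin

lemma reparametrized_has_derivative:
  assumes "y \<in> S"
  shows "frechet_derivative g\<^sub>2 (at y) v =
    frechet_derivative g\<^sub>1 (at (\<phi> y)) (frechet_derivative \<phi> (at y) v)"
proof -
  have "\<phi> y \<in> D" using S assms by auto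
  from has_derivative_compose[OF smooth_on_has_derivative[OF S(2) assms]
      smooth_on_has_derivative[OF D(2) this]]
  have "(g\<^sub>2 has_derivative (\<lambda>v. frechet_derivative g\<^sub>1 (at (\<phi> y)) (frechet_derivative \<phi> (at y)
      v))) (at y)"
    by (rule has_derivative_transform_within_open[OF _ S(1) assms]) (use S(4) in simp)
  from frechet_derivative_at[OF this] show ?thesis by metis
qed

text \<open>The extra term is tangent to the surface, so it disappears against any normal vector.\<close>

lemma reparametrized_second_derivative:
  "second_derivative g\<^sub>2 x v w =
    second_derivative g\<^sub>1 (\<phi> x) (frechet_derivative \<phi> (at x) v) (frechet_derivative \<phi> (at x) w)
    + frechet_derivative g\<^sub>1 (at (\<phi> x)) (second_derivative \<phi> x v w)"
proof -
  have "\<phi> x \<in> D" using S x by auto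
  from has_derivative_frechet_apply[OF D this smooth_on_has_derivative[OF S(2) x]
      smooth_on_has_derivative[OF smooth_on_frechet_const[OF S(1,2), of w] x]]
  have "((\<lambda>y. frechet_derivative g\<^sub>1 (at (\<phi> y)) (frechet_derivative \<phi> (at y) w)) has_derivative
     (\<lambda>v. second_derivative g\<^sub>1 (\<phi> x) (frechet_derivative \<phi> (at x) v) (frechet_derivative \<phi> (at x) w)
       + frechet_derivative g\<^sub>1 (at (\<phi> x)) (second_derivative \<phi> x v w))) (at x)"
    unfolding second_derivative_def[of \<phi>] .
  from has_derivative_transform_within_open[OF this S(1) x, of "\<lambda>y. frechet_derivative g\<^sub>2 (at y) w"]
  have "((\<lambda>y. frechet_derivative g\<^sub>2 (at y) w) has_derivative
     (\<lambda>v. second_derivative g\<^sub>1 (\<phi> x) (frechet_derivative \<phi> (at x) v) (frechet_derivative \<phi> (at x) w)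
       + frechet_derivative g\<^sub>1 (at (\<phi> x)) (second_derivative \<phi> x v w))) (at x)"
    using reparametrized_has_derivative by simp
  from fun_cong[OF frechet_derivative_at[OF this], of v] show ?thesis
    unfolding second_derivative_def[of g\<^sub>2] by simp
qed

lemma inj_coordinate_change: "inj (frechet_derivative \<phi> (at x))"
  using inj reparametrized_has_derivative[OF x] unfolding inj_def by metis

lemma surj_coordinate_change: "surj (frechet_derivative \<phi> (at x))"
  using linear_injective_imp_surjective[OF smooth_on_linear[OF S(2) x] inj_coordinate_change] by simp

lemma reparametrized_tangent_plane:
  "affine_tangent_plane_in g\<^sub>2 x = affine_tangent_plane_in g\<^sub>1 (\<phi> x)"
proof -
  have "affine_tangent_plane_in g\<^sub>2 x =
      (\<lambda>v. g\<^sub>1 (\<phi> x) + frechet_derivative g\<^sub>1 (at (\<phi> x)) v) ` range (frechet_derivative \<phi> (at x))"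
    by (auto simp: affine_tangent_plane_in_def reparametrized_has_derivative[OF x] S(4)[OF x])
  then show ?thesis by (simp add: surj_coordinate_change affine_tangent_plane_in_def)
qed

lemma reparametrized_sgn_gauss_curvature:
  "sgn (gauss_curvature_in g\<^sub>2 x) = sgn (gauss_curvature_in g\<^sub>1 (\<phi> x))"
proof -
  let ?P = "frechet_derivative \<phi> (at x)"
  define n where "n = cross3 (frechet_derivative g\<^sub>1 (at (\<phi> x)) (axis 1 1)) (frechet_derivative
      g\<^sub>1 (at (\<phi> x)) (axis 2 1))"
  have \<phi>x: "\<phi> x \<in> D" using S x by auto
  note l1 = smooth_on_linear[OF D(2) \<phi>x]
  have n0: "n \<noteq> 0" unfolding n_def by (rule cross_nonzero_if_inj[OF l1 inj1])
  have n1: "frechet_derivative g\<^sub>1 (at (\<phi> x)) v \<bullet> n = 0" for v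
    by (subst axis_expansion[of v])
      (simp add: linear_add[OF l1] linear_cmul[OF l1] n_def dot_cross_self inner_add_left)
  have n2: "frechet_derivative g\<^sub>2 (at x) v \<bullet> n = 0" for v
    by (simp add: reparametrized_has_derivative[OF x] n1)
  have s2: "smooth_on S g\<^sub>2"
    by (rule smooth_on_cong[OF S(1) _ smooth_on_compose[OF S(1) D(1) S(3,2) D(2)]]) (simp add: S(4))
  have "hessian_det g\<^sub>2 x n = (det2 (?P (axis 1 1)) (?P (axis 2 1)))\<^sup>2 * hessian_det g\<^sub>1 (\<phi> x) n"
    unfolding hessian_det_frame[OF D \<phi>x, symmetric]
    by (simp add: hessian_det_def reparametrized_second_derivative inner_add_left n1)
  moreover have "det2 (?P (axis 1 1)) (?P (axis 2 1)) \<noteq> 0"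
  proof
    assume 0: "det2 (?P (axis 1 1)) (?P (axis 2 1)) = 0"
    have l: "linear ?P" by (rule smooth_on_linear[OF S(2) x])
    have "?P (axis 2 1) \<noteq> 0"
      using linear_injective_0[OF l] inj_coordinate_change by auto
    then obtain c where "?P (axis 1 1) = c *\<^sub>R ?P (axis 2 1)" using det2_zero[OF 0] by blast
    then have "?P (axis 1 1) = ?P (c *\<^sub>R axis 2 1)" by (simp add: linear_cmul[OF l])
    then have "axis 1 1 = c *\<^sub>R (axis 2 1 :: real^2)" using inj_coordinate_change by (simp add:
        inj_eq)
    then show False by (simp add: vec_eq_iff forall_2 axis_def)
  qed
  ultimately have "sgn (hessian_det g\<^sub>2 x n) = sgn (hessian_det g\<^sub>1 (\<phi> x) n)"
    by (simp add: sgn_square_mult)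
  then show ?thesis
    using sgn_gauss_curvature[OF S(1) s2 x inj n0 n2] sgn_gauss_curvature[OF D \<phi>x inj1 n0 n1] by simp
qed

end

section \<open>Local convexity where the curvature is positive\<close>

text \<open>The normal \<open>n\<close> at \<open>y\<close> is kept fixed. The Hessian of the height \<open>n \<bullet> g\<close> has positive determinant
  and, after orienting \<open>n\<close>, positive first entry at \<open>y\<close>, hence also on a small ball. There the height
  is convex along segments from \<open>y\<close>, where its derivative vanishes.\<close>

lemma convex_near_positive_gauss_curvature:
  assumes D: "open D" "smooth_on D g" and y: "y \<in> D" and inj: "inj (frechet_derivative g (at y))"
    and K: "gauss_curvature_in g y > 0"
  obtains r where "r > 0" "ball y r \<subseteq> D" "on_one_side (g ` ball y r) (affine_tangent_plane_in g y)"
proof -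
  let ?e = "axis 1 1 :: real^2" and ?f = "axis 2 1 :: real^2"
  define m where "m = cross3 (frechet_derivative g (at y) ?e) (frechet_derivative g (at y) ?f)"
  note l = smooth_on_linear[OF D(2) y]
  have m0: "m \<noteq> 0" unfolding m_def by (rule cross_nonzero_if_inj[OF l inj])
  \<comment> \<open>oriented so that the first diagonal entry of the Hessian becomes positive\<close>
  define n where "n = sgn (second_derivative g y ?e ?e \<bullet> m) *\<^sub>R m"
  have dm: "hessian_det g y m > 0"
    using gauss_curvature_hessian_det[of g y] m0 K
    by (simp add: partial_def m_def[symmetric] zero_less_divide_iff)
  then have "second_derivative g y ?e ?e \<bullet> m \<noteq> 0"
    by (auto simp: hessian_det_def)
  then have n0: "n \<noteq> 0" and pos: "second_derivative g y ?e ?e \<bullet> n > 0" and dn: "hessian_det g y n > 0"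
    using m0 dm by (auto simp: n_def hessian_det_scaleR sgn_if)
  have n1: "frechet_derivative g (at y) v \<bullet> n = 0" for v
    by (subst axis_expansion[of v])
      (simp add: linear_add[OF l] linear_cmul[OF l] n_def m_def dot_cross_self inner_add_left)
  have c: "continuous_on D (\<lambda>z. second_derivative g z v w)" for v w
    by (rule smooth_on_continuous_on[OF smooth_on_second_derivative[OF D]])
  define U where "U = {z\<in>D. 0 < second_derivative g z ?e ?e \<bullet> n} \<inter> {z\<in>D. 0 < hessian_det g z n}"
  have "open U"
    unfolding U_def hessian_det_def
    by (intro open_Int open_positive_set D(1) continuous_intros c)
  moreover have UD: "U \<subseteq> D" by (auto simp: U_def)
  moreover have "y \<in> U" using y pos dn by (simp add: U_def)
  ultimately obtain r where r: "r > 0" "ball y r \<subseteq> U"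
    using open_contains_ball by blast
  have semi: "second_derivative g z u u \<bullet> n \<ge> 0" if "z \<in> ball y r" for z u
  proof -
    have z: "z \<in> D" and p: "second_derivative g z ?e ?e \<bullet> n > 0" "hessian_det g z n > 0"
      using r(2) that by (auto simp: U_def)
    have "(second_derivative g z ?e ?e \<bullet> n) * (second_derivative g z u u \<bullet> n)
        = (second_derivative g z ?e u \<bullet> n)\<^sup>2 + (det2 ?e u)\<^sup>2 * hessian_det g z n"
      using hessian_det_frame[OF D z, of ?e n u] by simp
    also have "\<dots> \<ge> 0" using p by simp
    finally show ?thesis using p(1) by (simp add: zero_le_mult_iff)
  qed
  have above: "n \<bullet> g y \<le> n \<bullet> g z" if z: "z \<in> ball y r" for z
  proof -
    define u where "u = z - y"
    have b: "y + t *\<^sub>R u \<in> ball y r" if "0 \<le> t" "t \<le> 1" for t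
    proof -
      have "t * norm u \<le> 1 * norm u" using that by (intro mult_right_mono) auto
      then show ?thesis using z that by (simp add: u_def dist_norm norm_minus_commute)
    qed
    have bD: "y + t *\<^sub>R u \<in> D" if "0 \<le> t" "t \<le> 1" for t using b[OF that] r(2) UD by blast
    have dl: "((\<lambda>t. y + t *\<^sub>R u) has_derivative (\<lambda>h. h *\<^sub>R u)) (at t)" for t
      by (auto intro!: derivative_eq_intros)
    have d1: "((\<lambda>t. g (y + t *\<^sub>R u) \<bullet> n) has_real_derivative
        frechet_derivative g (at (y + t *\<^sub>R u)) u \<bullet> n) (at t)" if "0 \<le> t" "t \<le> 1" for t
      using has_derivative_inner_left[OF has_derivative_compose[OF dl smooth_on_has_derivative[OF
          D(2) bD[OF that]]], of n]
        linear_cmul[OF smooth_on_linear[OF D(2) bD[OF that]]]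
      unfolding has_field_derivative_def by (simp add: mult_commute_abs)
    have d2: "((\<lambda>t. frechet_derivative g (at (y + t *\<^sub>R u)) u \<bullet> n) has_real_derivative
        second_derivative g (y + t *\<^sub>R u) u u \<bullet> n) (at t)" if "0 \<le> t" "t \<le> 1" for t
      using has_derivative_inner_left[OF has_derivative_compose[OF dl
            smooth_on_has_derivative[OF smooth_on_frechet_const[OF D] bD[OF that]]], of u n]
        linear_cmul[OF second_derivative_linear(1)[OF D bD[OF that]], of _ u u]
      unfolding has_field_derivative_def second_derivative_def by (simp add: mult_commute_abs)
    have slope: "frechet_derivative g (at (y + t *\<^sub>R u)) u \<bullet> n \<ge> 0" if t: "0 \<le> t" "t \<le> 1" for t
    proof -
      have "frechet_derivative g (at (y + 0 *\<^sub>R u)) u \<bullet> n \<le> frechet_derivative g (at (y + t *\<^sub>R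
          u)) u \<bullet> n"
      proof (rule DERIV_nonneg_imp_nondecreasing[OF t(1)])
        fix s assume "0 \<le> s" "s \<le> t"
        then have s: "0 \<le> s" "s \<le> 1" using t by auto
        show "\<exists>k. ((\<lambda>t. frechet_derivative g (at (y + t *\<^sub>R u)) u \<bullet> n) has_real_derivative k) (at
            s) \<and> 0 \<le> k"
          using d2[OF s] semi[OF b[OF s]] by blast
      qed
      then show ?thesis by (simp add: n1)
    qed
    have "g (y + 0 *\<^sub>R u) \<bullet> n \<le> g (y + 1 *\<^sub>R u) \<bullet> n"
      by (rule DERIV_nonneg_imp_nondecreasing[OF zero_le_one]) (use d1 slope in blast)
    then show ?thesis by (simp add: u_def inner_commute)
  qed
  have "affine_tangent_plane_in g y = {u. n \<bullet> u = n \<bullet> g y}"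
  proof (intro set_eqI iffI)
    fix u assume "u \<in> affine_tangent_plane_in g y"
    then show "u \<in> {u. n \<bullet> u = n \<bullet> g y}"
      using n1 by (auto simp: affine_tangent_plane_in_def inner_add_right inner_commute)
  next
    fix u assume "u \<in> {u. n \<bullet> u = n \<bullet> g y}"
    then have "(u - g y) \<bullet> n = 0" by (simp add: inner_commute[of _ n] inner_diff_right)
    then have "(u - g y) \<bullet> m = 0" using n0 by (auto simp: n_def)
    then obtain a b where "u - g y = a *\<^sub>R frechet_derivative g (at y) ?e + b *\<^sub>R
        frechet_derivative g (at y) ?f"
      using span_if_orthogonal_cross[of "u - g y"] m0 unfolding m_def by blast
    then have "u = g y + frechet_derivative g (at y) (a *\<^sub>R ?e + b *\<^sub>R ?f)"
      by (simp add: linear_add[OF l] linear_cmul[OF l] algebra_simps)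
    then show "u \<in> affine_tangent_plane_in g y" by (auto simp: affine_tangent_plane_in_def)
  qed
  then have "on_one_side (g ` ball y r) (affine_tangent_plane_in g y)"
    using n0 above unfolding on_one_side_def by blast
  moreover have "ball y r \<subseteq> D" using r(2) UD by blast
  ultimately show ?thesis using that r(1) by blast
qed

section \<open>The adapted frame at a lightlike point of the first kind\<close>

lemma has_derivative_ds2:
  assumes D: "open D" "smooth_on D g" "F a \<in> D"
    and F: "(F has_derivative F') (at a)" and Y: "(Y has_derivative Y') (at a)" and Z: "(Z
        has_derivative Z') (at a)"
  shows "((\<lambda>s. ds2 g (F s) (Y s) (Z s)) has_derivative
    (\<lambda>h. lorentz (frechet_derivative g (at (F a)) (Y a))
          (second_derivative g (F a) (F' h) (Z a) + frechet_derivative g (at (F a)) (Z' h))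
      + lorentz (second_derivative g (F a) (F' h) (Y a) + frechet_derivative g (at (F a)) (Y' h))
          (frechet_derivative g (at (F a)) (Z a)))) (at a)"
proof -
  note 1 = has_derivative_frechet_apply[where F = F and a = a, OF D F]
  from bounded_bilinear.FDERIV[OF bounded_bilinear_lorentz 1[OF Y] 1[OF Z]] show ?thesis
    unfolding ds2_def .
qed

lemma lorentz_null_vector:
  "null_vector g x w \<Longrightarrow> lorentz (frechet_derivative g (at x) v) (frechet_derivative g (at x) w) = 0"
  "null_vector g x w \<Longrightarrow> lorentz (frechet_derivative g (at x) w) (frechet_derivative g (at x) v) = 0"
proof -
  show 1: "null_vector g x w \<Longrightarrow> lorentz (frechet_derivative g (at x) w) (frechet_derivative g (at
      x) v) = 0"
    by (simp add: null_vector_def ds2_def)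
  then show "null_vector g x w \<Longrightarrow> lorentz (frechet_derivative g (at x) v) (frechet_derivative g (at
      x) w) = 0"
    by (subst lorentz_commute)
qed

text \<open>Of the derivative of \<open>\<langle>df(Z), df(Z)\<rangle>\<close> only the second derivative term survives: the variation of \<open>Z\<close>
  contributes a tangent vector, which is orthogonal to the null vector.\<close>

lemma has_derivative_ds2_null:
  assumes D: "open D" "smooth_on D g" "F a \<in> D" and null: "null_vector g (F a) (Z a)"
    and F: "(F has_derivative F') (at a)" and Z: "(Z has_derivative Z') (at a)"
  shows "((\<lambda>s. ds2 g (F s) (Z s) (Z s)) has_derivative
    (\<lambda>h. 2 * lorentz (second_derivative g (F a) (F' h) (Z a)) (frechet_derivative g (at (F a)) (Z
        a)))) (at a)"
proof -
  have "lorentz (frechet_derivative g (at (F a)) (Z a))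
          (second_derivative g (F a) (F' h) (Z a) + frechet_derivative g (at (F a)) (Z' h))
      + lorentz (second_derivative g (F a) (F' h) (Z a) + frechet_derivative g (at (F a)) (Z' h))
          (frechet_derivative g (at (F a)) (Z a))
      = 2 * lorentz (second_derivative g (F a) (F' h) (Z a)) (frechet_derivative g (at (F a)) (Z
          a))" for h
    using lorentz_commute[of "frechet_derivative g (at (F a)) (Z a)" "second_derivative g (F a)
        (F' h) (Z a)"]
    by (simp add: lorentz_bilinear_simps lorentz_null_vector[OF null])
  then show ?thesis using has_derivative_ds2[OF D F Z Z] by simp
qed

lemma null_vector_complement_nonneg:
  assumes w: "null_vector g x w" and l: "linear (frechet_derivative g (at x))"
    and inj: "inj (frechet_derivative g (at x))"
  shows "ds2 g x v v \<ge> 0"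
  unfolding ds2_def
proof (rule lorentz_nonneg_on_null_complement)
  show "frechet_derivative g (at x) w \<noteq> 0"
    using w linear_injective_0[OF l] inj unfolding null_vector_def by blast
qed (rule lorentz_null_vector[OF w])+

text \<open>The conditions that the velocity \<open>v\<close> of the unit speed lightlike curve and the value \<open>w\<close> of a
  normalized null vector field satisfy at the single point \<open>x\<close>. Neither the curve nor the field
  appears any more, which makes the comparison between charts a pointwise matter.\<close>

definition first_kind_frame :: "(real^2 \<Rightarrow> real^3) \<Rightarrow> real^2 \<Rightarrow> real^2 \<Rightarrow> real^2 \<Rightarrow> real \<Rightarrow> bool"
  where "first_kind_frame g x v w k \<longleftrightarrow>
    null_vector g x w \<and> ds2 g x v v = 1 \<and>
    lorentz (second_derivative g x w w) (frechet_derivative g (at x) w) = 1 / 2 \<and>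
    lorentz (second_derivative g x v w) (frechet_derivative g (at x) w) = 0 \<and>
    lorentz (second_derivative g x v v) (frechet_derivative g (at x) w) = k"

lemma null_vector_parallel:
  assumes l: "linear (frechet_derivative g (at x))"
    and w: "null_vector g x w" and w': "null_vector g x w'" and v: "ds2 g x v v \<noteq> 0"
  obtains c where "w' = c *\<^sub>R w" "c \<noteq> 0"
proof -
  have "det2 w' w = 0"
  proof (rule ccontr)
    assume d: "det2 w' w \<noteq> 0"
    have "ds2 g x v v = ds2 g x v ((det2 v w / det2 w' w) *\<^sub>R w' + (det2 w' v / det2 w' w) *\<^sub>R w)"
      using det2_expansion[OF d, of v] by simp
    also have "\<dots> = 0"
      using w w' by (simp only: linear_add[OF ds2_bilinear(2)[OF l]] linear_cmul[OF
          ds2_bilinear(2)[OF l]])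
        (simp add: null_vector_def ds2_commute[of g x v w] ds2_commute[of g x v w'])
    finally show False using v by simp
  qed
  moreover have "w \<noteq> 0" "w' \<noteq> 0" using w w' by (auto simp: null_vector_def)
  ultimately show ?thesis using det2_zero that by (metis scaleR_zero_left)
qed

lemma det2_frame_nonzero:
  assumes l: "linear (frechet_derivative g (at x))"
    and w: "null_vector g x w" and v: "ds2 g x v v \<noteq> 0"
  shows "det2 v w \<noteq> 0"
proof
  assume "det2 v w = 0"
  then obtain c where "v = c *\<^sub>R w" using det2_zero w by (auto simp: null_vector_def)
  then have "ds2 g x v v = 0"
    using w by (simp add: linear_cmul[OF ds2_bilinear(1)[OF l]] null_vector_def)
  then show False using v by simp
qed

text \<open>Write \<open>B(a, b) = \<langle>D\<^sup>2g(a, b), dg(w)\<rangle>\<close>. Replacing \<open>w\<close> by \<open>c w\<close> multiplies \<open>B(w, w)\<close> by \<open>c\<^sup>3\<close>, so the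
  normalization pins down \<open>w\<close>. Then \<open>B(v, w) = 0\<close> pins down the line of \<open>v\<close>, as \<open>B(w, w) \<noteq> 0\<close>, and
  unit length fixes \<open>v\<close> up to sign, to which \<open>B(v, v)\<close> is insensitive.\<close>

lemma first_kind_frame_unique:
  assumes D: "open D" "smooth_on D g" "x \<in> D"
    and f: "first_kind_frame g x v w k" and f': "first_kind_frame g x v' w' k'"
  shows "k' = k"
proof -
  note l = smooth_on_linear[OF D(2,3)]
  note S = second_derivative_linear[OF D]
  note simps = linear_add[OF l] linear_cmul[OF l] linear_add[OF S(1)] linear_cmul[OF S(1)]
    linear_add[OF S(2)] linear_cmul[OF S(2)] lorentz_bilinear_simps
  have w: "null_vector g x w" and w': "null_vector g x w'" and v: "ds2 g x v v = 1" "ds2 g x v' v'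
      = 1"
    using f f' by (auto simp: first_kind_frame_def)
  obtain c where c: "w' = c *\<^sub>R w" "c \<noteq> 0"
    using null_vector_parallel[OF l w w', of v] v by auto
  have "lorentz (second_derivative g x w w) (frechet_derivative g (at x) w) = 1 / 2"
    "lorentz (second_derivative g x w' w') (frechet_derivative g (at x) w') = 1 / 2"
    using f f' by (auto simp: first_kind_frame_def)
  then have "c ^ 3 * (1 / 2) = 1 / 2"
    by (simp only: c simps power3_eq_cube mult.assoc)
  then have "c ^ 3 = 1" by simp
  then have "c = 1" using odd_real_root_power_cancel[of 3 c] by simp
  then have ww: "w' = w" using c by simp
  define \<alpha> \<beta> where "\<alpha> = det2 v' w / det2 v w" and "\<beta> = det2 v v' / det2 v w"
  have v': "v' = \<alpha> *\<^sub>R v + \<beta> *\<^sub>R w"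
    unfolding \<alpha>_def \<beta>_def using det2_expansion det2_frame_nonzero[OF l w] v by simp
  have "\<beta> = 0"
    using f f' by (simp add: first_kind_frame_def ww v' simps)
  then have v': "v' = \<alpha> *\<^sub>R v" using v' by simp
  have "\<alpha> * \<alpha> = 1"
    using v by (simp add: v' linear_cmul[OF ds2_bilinear(1)[OF l]] linear_cmul[OF
        ds2_bilinear(2)[OF l]])
  moreover have "k' = \<alpha> * \<alpha> * k"
    using f f' by (auto simp: first_kind_frame_def ww v' simps)
  ultimately show ?thesis by simp
qed

lemma (in coordinate_change) first_kind_frame_transfer:
  assumes "first_kind_frame g\<^sub>2 x v w k"
  shows "first_kind_frame g\<^sub>1 (\<phi> x) (frechet_derivative \<phi> (at x) v) (frechet_derivative \<phi> (at x) w) k"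
proof -
  let ?P = "frechet_derivative \<phi> (at x)"
  have lP: "linear ?P" by (rule smooth_on_linear[OF S(2) x])
  have null2: "null_vector g\<^sub>2 x w" using assms by (simp add: first_kind_frame_def)
  have ds: "ds2 g\<^sub>2 x u u' = ds2 g\<^sub>1 (\<phi> x) (?P u) (?P u')" for u u'
    by (simp add: ds2_def reparametrized_has_derivative[OF x])
  have null1: "null_vector g\<^sub>1 (\<phi> x) (?P w)"
    unfolding null_vector_def
  proof (intro conjI allI)
    show "?P w \<noteq> 0"
      using null2 linear_injective_0[OF lP] inj_coordinate_change by (auto simp: null_vector_def)
    show "ds2 g\<^sub>1 (\<phi> x) (?P w) u = 0" for u
    proof -
      obtain u' where "u = ?P u'" using surj_coordinate_change by (metis surjD)
      then show ?thesis using null2 by (simp add: null_vector_def ds)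
    qed
  qed
  have "lorentz (second_derivative g\<^sub>2 x u u') (frechet_derivative g\<^sub>2 (at x) w) =
      lorentz (second_derivative g\<^sub>1 (\<phi> x) (?P u) (?P u')) (frechet_derivative g\<^sub>1 (at (\<phi> x)) (?P
          w))" for u u'
    by (simp only: reparametrized_has_derivative[OF x] reparametrized_second_derivative
        lorentz_bilinear_simps lorentz_null_vector[OF null1] add_0_right)
  then show ?thesis
    using assms null1 unfolding first_kind_frame_def ds by simp
qed

lemma first_kind_frame_gauss_curvature:
  assumes D: "open D" "smooth_on D g" "x \<in> D" and inj: "inj (frechet_derivative g (at x))"
    and f: "first_kind_frame g x v w k"
  shows "sgn (gauss_curvature_in g x) = sgn k"
proof -
  note l = smooth_on_linear[OF D(2,3)]
  define n where "n = lorentz_dual (frechet_derivative g (at x) w)"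
  have w: "null_vector g x w" using f by (simp add: first_kind_frame_def)
  have "n \<noteq> 0"
    using w linear_injective_0[OF l] inj by (auto simp: n_def lorentz_dual_eq_0 null_vector_def)
  moreover have "frechet_derivative g (at x) u \<bullet> n = 0" for u
    by (simp add: n_def lorentz_dual_inner lorentz_null_vector[OF w])
  ultimately have s: "sgn (gauss_curvature_in g x) = sgn (hessian_det g x n)"
    by (rule sgn_gauss_curvature[OF D inj])
  have "(det2 v w)\<^sup>2 * hessian_det g x n = k / 2"
    using hessian_det_frame[OF D, of v n w, symmetric] f
    by (simp add: n_def lorentz_dual_inner first_kind_frame_def)
  moreover have "det2 v w \<noteq> 0"
    using det2_frame_nonzero[OF l w] f by (simp add: first_kind_frame_def)
  ultimately have "sgn (hessian_det g x n) = sgn (k / 2)"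
    by (metis sgn_square_mult)
  then show ?thesis using s by (simp add: sgn_divide)
qed

lemma LD_curveD:
  assumes "LD_curve g D x a b \<gamma>"
  shows "0 \<in> {a<..<b}" "\<gamma> 0 = x" "smooth_on {a<..<b} \<gamma>"
  using assms unfolding LD_curve_def greaterThanLessThan_iff by blast+

lemma LD_curve_in:
  assumes "LD_curve g D x a b \<gamma>" "t \<in> {a<..<b}"
  shows "\<gamma> t \<in> D" "lightlike_in g (\<gamma> t)"
proof -
  have "\<gamma> t \<in> \<gamma> ` {a<..<b}" using assms(2) by (rule imageI)
  then have "\<gamma> t \<in> LD_in g D" using assms(1) unfolding LD_curve_def by blast
  then show "\<gamma> t \<in> D" "lightlike_in g (\<gamma> t)" by (simp_all add: LD_in_def)
qed

lemma smooth_curve_has_vector_derivative: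
  assumes "smooth_on {a<..<b} \<gamma>" "t \<in> {a<..<b}"
  shows "(\<gamma> has_vector_derivative frechet_derivative \<gamma> (at t) 1) (at t)"
    and "vector_derivative \<gamma> (at t) = frechet_derivative \<gamma> (at t) 1"
proof -
  show 1: "(\<gamma> has_vector_derivative frechet_derivative \<gamma> (at t) 1) (at t)"
  proof -
    have "frechet_derivative \<gamma> (at t) h = h *\<^sub>R frechet_derivative \<gamma> (at t) 1" for h
      using linear_cmul[OF smooth_on_linear[OF assms], of h 1] by simp
    then have "frechet_derivative \<gamma> (at t) = (\<lambda>h. h *\<^sub>R frechet_derivative \<gamma> (at t) 1)" by (rule ext)
    with smooth_on_has_derivative[OF assms] show ?thesis
      unfolding has_vector_derivative_def by (rule has_derivative_eq_rhs)
  qed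
  then show "vector_derivative \<gamma> (at t) = frechet_derivative \<gamma> (at t) 1"
    by (rule vector_derivative_at)
qed

lemma lift_curve_vector_derivative:
  assumes D: "smooth_on D g" and \<gamma>: "smooth_on {a<..<b} \<gamma>" and t: "t \<in> {a<..<b}" "\<gamma> t \<in> D"
  shows "vector_derivative (g \<circ> \<gamma>) (at t) = frechet_derivative g (at (\<gamma> t)) (frechet_derivative \<gamma>
      (at t) 1)"
proof (rule vector_derivative_at)
  have "((g \<circ> \<gamma>) has_derivative
      (\<lambda>h. frechet_derivative g (at (\<gamma> t)) (h *\<^sub>R frechet_derivative \<gamma> (at t) 1))) (at t)"
    using has_derivative_compose[OF smooth_curve_has_vector_derivative(1)[OF \<gamma> t(1), unfolded
        has_vector_derivative_def]
        smooth_on_has_derivative[OF D t(2)]] by (simp add: o_def)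
  then show "((g \<circ> \<gamma>) has_vector_derivative
      frechet_derivative g (at (\<gamma> t)) (frechet_derivative \<gamma> (at t) 1)) (at t)"
    by (simp add: has_vector_derivative_def linear_cmul[OF smooth_on_linear[OF D t(2)]])
qed

text \<open>\<open>\<langle>df(\<eta>), df(\<eta>)\<rangle>\<close> vanishes along the lightlike curve, and its derivative there is twice the
  left hand side.\<close>

lemma null_field_along_LD_curve:
  assumes D: "open D" "smooth_on D g" "x \<in> D"
    and \<gamma>: "LD_curve g D x a b \<gamma>" and V: "x \<in> V" "null_vector_field g D V \<eta>"
  shows "lorentz (second_derivative g x (vector_derivative \<gamma> (at 0)) (\<eta> x)) (frechet_derivative g
      (at x) (\<eta> x)) = 0"
proof -
  have ab: "0 \<in> {a<..<b}" and x: "\<gamma> 0 = x" and sm: "smooth_on {a<..<b} \<gamma>"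
    using LD_curveD[OF \<gamma>] .
  have oV: "open V" and s\<eta>: "smooth_on V \<eta>" and null: "\<And>q. q \<in> LD_in g D \<inter> V \<Longrightarrow> null_vector g q (\<eta> q)"
    using V(2) by (auto simp: null_vector_field_def)
  have d: "(\<gamma> has_derivative (\<lambda>h. h *\<^sub>R vector_derivative \<gamma> (at 0))) (at 0)"
    using smooth_curve_has_vector_derivative[OF sm ab] by (simp add: has_vector_derivative_def)
  have d\<eta>: "((\<lambda>t. \<eta> (\<gamma> t)) has_derivative
      (\<lambda>h. frechet_derivative \<eta> (at (\<gamma> 0)) (h *\<^sub>R vector_derivative \<gamma> (at 0)))) (at 0)"
    by (rule has_derivative_compose[OF d smooth_on_has_derivative[OF s\<eta>]]) (simp add: x V(1))
  have nx: "null_vector g (\<gamma> 0) (\<eta> (\<gamma> 0))"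
    using null LD_curve_in[OF \<gamma> ab] V(1) by (simp add: LD_in_def x)
  have d1: "((\<lambda>t. ds2 g (\<gamma> t) (\<eta> (\<gamma> t)) (\<eta> (\<gamma> t))) has_derivative
      (\<lambda>h. 2 * lorentz (second_derivative g x (h *\<^sub>R vector_derivative \<gamma> (at 0)) (\<eta> x))
          (frechet_derivative g (at x) (\<eta> x)))) (at 0)"
    using has_derivative_ds2_null[OF D(1,2) _ nx d d\<eta>] D(3) by (simp add: x)
  have "continuous_on {a<..<b} \<gamma>" using sm by (rule smooth_on_continuous_on)
  then have "open ({a<..<b} \<inter> \<gamma> -` V)"
    using open_greaterThanLessThan oV by (rule continuous_open_preimage)
  moreover have "0 \<in> {a<..<b} \<inter> \<gamma> -` V" using ab x V(1) by auto
  ultimately have d2: "((\<lambda>t. ds2 g (\<gamma> t) (\<eta> (\<gamma> t)) (\<eta> (\<gamma> t))) has_derivative (\<lambda>h. 0)) (at 0)"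
  proof (rule has_derivative_transform_within_open[OF has_derivative_const[of 0]])
    fix t assume "t \<in> {a<..<b} \<inter> \<gamma> -` V"
    then have "null_vector g (\<gamma> t) (\<eta> (\<gamma> t))"
      using null LD_curve_in[OF \<gamma>, of t] by (auto simp: LD_in_def)
    then show "0 = ds2 g (\<gamma> t) (\<eta> (\<gamma> t)) (\<eta> (\<gamma> t))" by (simp add: null_vector_def)
  qed
  from fun_cong[OF has_derivative_unique[OF d1 d2], of 1] show ?thesis by simp
qed

lemma lightlike_singular_curvature_frame:
  assumes D: "open D" "smooth_on D g" "x \<in> D" and inj: "inj (frechet_derivative g (at x))"
    and k: "is_lightlike_singular_curvature_in g D x k"
  obtains v w where "first_kind_frame g x v w k"
proof -
  obtain a b \<gamma> V \<eta> where \<gamma>: "LD_curve g D x a b \<gamma>"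
    and unit: "\<And>t. t\<in>{a<..<b} \<Longrightarrow> lorentz_norm (vector_derivative (g \<circ> \<gamma>) (at t)) = 1"
    and xV: "x \<in> V" and \<eta>: "normalized_null_vector_field g D V \<eta>"
    and keq: "k = lorentz (vector_derivative (\<lambda>t. vector_derivative (g \<circ> \<gamma>) (at t)) (at 0))
                   (tangent_map g (\<gamma> 0) (\<eta> (\<gamma> 0)))"
    using k unfolding is_lightlike_singular_curvature_in_def by blast
  have ab: "0 \<in> {a<..<b}" and x: "\<gamma> 0 = x" and sm: "smooth_on {a<..<b} \<gamma>"
    using LD_curveD[OF \<gamma>] .
  have nf: "null_vector_field g D V \<eta>" using \<eta> by (simp add: normalized_null_vector_field_def)
  have s\<eta>: "smooth_on V \<eta>" using nf by (simp add: null_vector_field_def)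
  have xLD: "x \<in> LD_in g D \<inter> V" using LD_curve_in[OF \<gamma> ab] xV by (simp add: LD_in_def x)
  have null: "null_vector g x (\<eta> x)"
    using nf xLD by (auto simp: null_vector_field_def)
  define v where "v = frechet_derivative \<gamma> (at 0) 1"
  define w where "w = \<eta> x"
  note l = smooth_on_linear[OF D(2,3)]
  have lift: "vector_derivative (g \<circ> \<gamma>) (at t) = frechet_derivative g (at (\<gamma> t))
      (frechet_derivative \<gamma> (at t) 1)"
    if "t \<in> {a<..<b}" for t
    by (rule lift_curve_vector_derivative[OF D(2) sm that LD_curve_in(1)[OF \<gamma> that]])
  have "\<bar>ds2 g x v v\<bar> = 1"
    using unit[OF ab] by (simp add: lorentz_norm_def lift[OF ab] x v_def ds2_def)
  then have vv: "ds2 g x v v = 1"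
    using null_vector_complement_nonneg[OF null l inj, of v] by linarith
  have dx: "((\<lambda>y. ds2 g y (\<eta> y) (\<eta> y)) has_derivative
      (\<lambda>h. 2 * lorentz (second_derivative g x h (\<eta> x)) (frechet_derivative g (at x) (\<eta> x)))) (at x)"
    by (rule has_derivative_ds2_null[OF D null has_derivative_ident smooth_on_has_derivative[OF s\<eta>
        xV]])
  have "frechet_derivative (\<lambda>y. ds2 g y (\<eta> y) (\<eta> y)) (at x) (\<eta> x) = 1"
    using \<eta> xLD by (auto simp: normalized_null_vector_field_def)
  then have ww: "lorentz (second_derivative g x w w) (frechet_derivative g (at x) w) = 1 / 2"
    unfolding frechet_derivative_at[OF dx, symmetric] w_def by simp
  have vw: "lorentz (second_derivative g x v w) (frechet_derivative g (at x) w) = 0"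
    using null_field_along_LD_curve[OF D \<gamma> xV nf] smooth_curve_has_vector_derivative(2)[OF sm ab]
    by (simp add: v_def w_def)
  define Z where "Z t = frechet_derivative \<gamma> (at t) 1" for t
  have sZ: "smooth_on {a<..<b} Z"
    unfolding Z_def by (rule smooth_on_frechet_const[OF _ sm]) simp
  have "((\<lambda>t. frechet_derivative g (at (\<gamma> t)) (Z t)) has_derivative
      (\<lambda>h. second_derivative g (\<gamma> 0) (h *\<^sub>R v) (Z 0) + frechet_derivative g (at (\<gamma> 0)) (h *\<^sub>R
          frechet_derivative Z (at 0) 1))) (at 0)"
    using smooth_curve_has_vector_derivative(1)[OF sm ab] smooth_curve_has_vector_derivative(1)[OF
        sZ ab]
    by (intro has_derivative_frechet_apply[OF D(1,2)]) (auto simp: has_vector_derivative_def v_def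
        x D(3))
  then have "((\<lambda>t. frechet_derivative g (at (\<gamma> t)) (Z t)) has_vector_derivative
      second_derivative g x v v + frechet_derivative g (at x) (frechet_derivative Z (at 0) 1)) (at 0)"
    by (simp add: has_vector_derivative_def x linear_cmul[OF l] linear_cmul[OF
        second_derivative_linear(1)[OF D]]
        Z_def v_def scaleR_add_right)
  then have "((\<lambda>t. vector_derivative (g \<circ> \<gamma>) (at t)) has_vector_derivative
      second_derivative g x v v + frechet_derivative g (at x) (frechet_derivative Z (at 0) 1)) (at 0)"
    by (rule has_vector_derivative_transform_within_open[OF _ open_greaterThanLessThan ab])
      (simp add: lift Z_def)
  then have "lorentz (second_derivative g x v v) (frechet_derivative g (at x) w) = k"
    unfolding keq by (simp add: vector_derivative_at x w_def lorentz_bilinear_simps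
        lorentz_null_vector[OF null])
  then show ?thesis
    using that null vv ww vw by (simp add: first_kind_frame_def w_def)
qed

section \<open>Existence of the lightlike singular curvature\<close>

text \<open>The solution of the differential equation \<open>\<sigma>' = P(\<sigma>)\<close>, obtained as the inverse of an antiderivative of
  \<open>1 / P\<close>; the equation itself then yields smoothness, one order at a time.\<close>

lemma inverse_antiderivative:
  fixes P :: "real \<Rightarrow> real"
  assumes P: "smooth_on {a<..<b} P" "\<And>t. t \<in> {a<..<b} \<Longrightarrow> P t > 0"
    and ac: "a < c" "c < 0" "0 < d" "d < b"
  obtains c' d' \<sigma> where "c' < 0" "0 < d'" "\<sigma> 0 = 0" "\<sigma> ` {c'<..<d'} = {c<..<d}"
    "smooth_on {c'<..<d'} \<sigma>" "\<And>t. t \<in> {c'<..<d'} \<Longrightarrow> (\<sigma> has_real_derivative P (\<sigma> t)) (at t)"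
proof -
  \<comment> \<open>a margin around \<open>{c..d}\<close>, so that the antiderivative has two-sided derivatives at the end points\<close>
  obtain c0 d0 where c0: "a < c0" "c0 < c" "d < d0" "d0 < b" using ac dense by metis
  define q where "q t = 1 / P t" for t
  have "continuous_on {c0..d0} P"
    by (rule continuous_on_subset[OF smooth_on_continuous_on[OF P(1)]]) (use c0 in auto)
  then have q: "continuous_on {c0..d0} q"
    unfolding q_def
  proof (intro continuous_intros)
    show "\<forall>t\<in>{c0..d0}. P t \<noteq> 0"
    proof
      fix t assume "t \<in> {c0..d0}"
      then show "P t \<noteq> 0" using P(2)[of t] c0 by auto
    qed
  qed
  define s where "s t = integral {c0..t} q - integral {c0..0} q" for t
  have sd: "(s has_real_derivative q t) (at t)" if "c \<le> t" "t \<le> d" for t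
  proof -
    have "(s has_real_derivative q t - 0) (at t within {c0..d0})"
      unfolding s_def by (rule DERIV_diff[OF integral_has_real_derivative[OF q]]) (use that c0 in
          auto)
    moreover have "t \<in> interior {c0..d0}" using that c0 by (simp add: interior_atLeastAtMost_real)
    ultimately show ?thesis using at_within_interior[of t "{c0..d0}"] by simp
  qed
  have qpos: "q t > 0" if "c \<le> t" "t \<le> d" for t
  proof -
    have "t \<in> {a<..<b}" using that ac by simp
    then show ?thesis using P(2) by (simp add: q_def)
  qed
  have mono: "s t < s t'" if "c \<le> t" "t < t'" "t' \<le> d" for t t'
  proof (rule DERIV_pos_imp_increasing[OF that(2)])
    fix r assume "t \<le> r" "r \<le> t'"
    then have "c \<le> r" "r \<le> d" using that by auto
    then show "\<exists>y. (s has_real_derivative y) (at r) \<and> 0 < y" using sd qpos by blast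
  qed
  have inj: "inj_on s {c..d}"
    by (rule linorder_inj_onI) (use mono in force)+
  define \<sigma> where "\<sigma> = the_inv_into {c..d} s"
  have \<sigma>s: "\<sigma> (s t) = t" if "c \<le> t" "t \<le> d" for t
    unfolding \<sigma>_def by (rule the_inv_into_f_f[OF inj]) (use that in simp)
  have cont: "isCont s t" if "c \<le> t" "t \<le> d" for t using sd[OF that] by (rule DERIV_isCont)
  have pre: "\<exists>t\<in>{c<..<d}. s t = y" if "y \<in> {s c<..<s d}" for y
  proof -
    have "\<exists>t\<ge>c. t \<le> d \<and> s t = y"
      by (rule IVT) (use that ac cont in auto)
    then obtain t where "c \<le> t" "t \<le> d" "s t = y" by blast
    moreover have "t \<noteq> c" "t \<noteq> d" using that \<open>s t = y\<close> by auto
    ultimately show ?thesis by (intro bexI[of _ t]) auto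
  qed
  have im: "\<sigma> ` {s c<..<s d} = {c<..<d}"
  proof (intro equalityI subsetI)
    fix t assume "t \<in> \<sigma> ` {s c<..<s d}"
    then obtain y where y: "y \<in> {s c<..<s d}" "t = \<sigma> y" by blast
    obtain r where "r \<in> {c<..<d}" "s r = y" using pre[OF y(1)] by blast
    then show "t \<in> {c<..<d}" using \<sigma>s[of r] y(2) by auto
  next
    fix t assume t: "t \<in> {c<..<d}"
    then have "s t \<in> {s c<..<s d}" using mono[of c t] mono[of t d] by auto
    moreover have "\<sigma> (s t) = t" using \<sigma>s t by auto
    ultimately show "t \<in> \<sigma> ` {s c<..<s d}" by (metis imageI)
  qed
  have s\<sigma>: "s (\<sigma> y) = y" if "y \<in> {s c<..<s d}" for y
    using pre[OF that] \<sigma>s by force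
  have \<sigma>d: "(\<sigma> has_real_derivative P (\<sigma> y)) (at y)" if y: "y \<in> {s c<..<s d}" for y
  proof -
    obtain r where r: "r \<in> {c<..<d}" "s r = y" using pre[OF y] by blast
    then have \<sigma>y: "\<sigma> y = r" using \<sigma>s[of r] by auto
    have "isCont \<sigma> (s r)"
      by (rule isCont_inverse_function2[of c r d]) (use r \<sigma>s cont in auto)
    then have "(\<sigma> has_real_derivative inverse (q r)) (at y)"
      using sd[of r] qpos[of r] r y s\<sigma>
      by (intro DERIV_inverse_function[where f = s and a = "s c" and b = "s d"]) (auto simp: \<sigma>y)
    then show ?thesis by (simp add: q_def \<sigma>y)
  qed
  have "Ck_on k {s c<..<s d} \<sigma>" for k
  proof (induction k)
    case 0
    show ?case
      using DERIV_isCont[OF \<sigma>d] by (simp add: continuous_at_imp_continuous_on)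
  next
    case (Suc k)
    show ?case
    proof (rule Ck_on_SucI[OF open_greaterThanLessThan])
      fix y assume "y \<in> {s c<..<s d}"
      then show "(\<sigma> has_derivative (\<lambda>h. P (\<sigma> y) * h)) (at y)"
        using \<sigma>d by (simp add: has_field_derivative_def)
    next
      fix e :: real assume "e \<in> Basis"
      moreover have "Ck_on k {s c<..<s d} (\<lambda>y. P (\<sigma> y))"
      proof (rule Ck_on_compose[OF open_greaterThanLessThan open_greaterThanLessThan _ Suc])
        show "\<sigma> ` {s c<..<s d} \<subseteq> {a<..<b}" unfolding im using ac by auto
        show "Ck_on k {a<..<b} P" using P(1) by (simp add: smooth_on_def)
      qed
      ultimately show "Ck_on k {s c<..<s d} (\<lambda>y. P (\<sigma> y) * e)" by simp
    qed
  qed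
  then have sm: "smooth_on {s c<..<s d} \<sigma>" by (simp add: smooth_on_def)
  have s0: "s 0 = 0" by (simp add: s_def)
  have "s c < 0" "0 < s d" using mono[of c 0] mono[of 0 d] ac s0 by auto
  moreover have "\<sigma> 0 = 0" using \<sigma>s[of 0] s0 ac by simp
  ultimately show ?thesis using that im sm \<sigma>d by blast
qed

lemma smooth_on_ds2:
  assumes D: "open D" "smooth_on D g" and V: "open V" "V \<subseteq> D" "smooth_on V \<eta>" "smooth_on V \<zeta>"
  shows "smooth_on V (\<lambda>y. ds2 g y (\<eta> y) (\<zeta> y))"
proof -
  note d = smooth_on_frechet_apply[OF V(1) smooth_on_subset[OF D(2) V(2)]]
  show ?thesis
    unfolding ds2_def by (rule smooth_on_bilinear[OF bounded_bilinear_lorentz V(1) d[OF V(3)] d[OF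
        V(4)]])
qed

lemma discriminant_frame:
  assumes "linear (frechet_derivative g (at y))"
  shows "(det2 v w)\<^sup>2 * discriminant g y = ds2 g y v v * ds2 g y w w - (ds2 g y v w)\<^sup>2"
proof -
  have "ds2 g y v v * ds2 g y w w - (ds2 g y v w)\<^sup>2 = (det2 v w)\<^sup>2 * discriminant g y"
    unfolding discriminant_def
  proof (rule binary_form_discriminant[of "ds2 g y"])
    show "linear (\<lambda>v. ds2 g y v w)" "linear (ds2 g y v)" for v w
      by (rule ds2_bilinear(1)[OF assms], rule ds2_bilinear(2)[OF assms])
    show "ds2 g y v w = ds2 g y w v" for v w by (rule ds2_commute)
  qed
  then show ?thesis by (rule sym)
qed

lemma smooth_on_discriminant:
  assumes D: "open D" "smooth_on D g"
  shows "smooth_on D (discriminant g)"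
proof -
  have s: "smooth_on D (\<lambda>y. ds2 g y v w)" for v w
    using D by (intro smooth_on_ds2) (auto intro: smooth_on_const)
  note B = smooth_on_bilinear[OF bounded_bilinear_mult D(1) s s]
  have "smooth_on D (\<lambda>y. ds2 g y (axis 1 1) (axis 1 1) * ds2 g y (axis 2 1) (axis 2 1)
     + - (ds2 g y (axis 1 1) (axis 2 1) * ds2 g y (axis 1 1) (axis 2 1)))"
    using B smooth_on_bounded_linear[OF bounded_linear_minus[OF bounded_linear_ident] D(1) B] D(1)
    unfolding smooth_on_def by (intro allI Ck_on_add) auto
  then show ?thesis
    by (rule smooth_on_cong[OF D(1), rotated]) (simp add: discriminant_def power2_eq_square)
qed

lemma lightlike_discriminant:
  assumes "linear (frechet_derivative g (at y))" "lightlike_in g y"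
  shows "discriminant g y = 0"
proof -
  obtain w where w: "null_vector g y w" using assms(2) by (auto simp: lightlike_in_def)
  \<comment> \<open>any vector independent of \<open>w\<close> would do; this is \<open>w\<close> rotated by a right angle\<close>
  define u :: "real^2" where "u = vector [- (w $ 2), w $ 1]"
  have "det2 w u = (w $ 1)\<^sup>2 + (w $ 2)\<^sup>2" by (simp add: u_def det2_def power2_eq_square)
  moreover have "w $ 1 \<noteq> 0 \<or> w $ 2 \<noteq> 0" using w by (auto simp: null_vector_def vec_eq_iff forall_2)
  ultimately have "det2 w u \<noteq> 0" by (auto simp: sum_power2_eq_zero_iff)
  moreover have "(det2 w u)\<^sup>2 * discriminant g y = 0"
    using w by (simp add: discriminant_frame[OF assms(1)] null_vector_def)
  ultimately show ?thesis by simp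
qed

text \<open>In the frame \<open>v, w\<close> the discriminant is \<open>ds\<^sup>2(v, v) ds\<^sup>2(w, w) - ds\<^sup>2(v, w)\<^sup>2\<close>. At \<open>x\<close> the factor
  \<open>ds\<^sup>2(w, w)\<close> vanishes, so that only its derivative counts, and the square vanishes to second order.\<close>

lemma discriminant_derivative_null:
  assumes D: "open D" "smooth_on D g" "x \<in> D" and w: "null_vector g x w"
  shows "(det2 v w)\<^sup>2 * frechet_derivative (discriminant g) (at x) u =
    2 * ds2 g x v v * lorentz (second_derivative g x u w) (frechet_derivative g (at x) w)"
proof -
  define T where "T = (\<lambda>u. 2 * lorentz (second_derivative g x u w) (frechet_derivative g (at x) w))"
  have c: "((\<lambda>y. c) has_derivative (\<lambda>u. 0)) (at x)" for c :: "real^2" by simp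
  have dw: "((\<lambda>y. ds2 g y w w) has_derivative T) (at x)"
    unfolding T_def by (rule has_derivative_ds2_null[OF D w has_derivative_ident c])
  obtain A where dv: "((\<lambda>y. ds2 g y v v) has_derivative A) (at x)"
    using has_derivative_ds2[OF D has_derivative_ident c c] by blast
  obtain B where dvw: "((\<lambda>y. ds2 g y v w) has_derivative B) (at x)"
    using has_derivative_ds2[OF D has_derivative_ident c c] by blast
  have z: "ds2 g x w w = 0" "ds2 g x v w = 0"
    using w by (simp_all add: null_vector_def ds2_commute[of g x v])
  have "((\<lambda>y. ds2 g y v v * ds2 g y w w - ds2 g y v w * ds2 g y v w) has_derivative
      (\<lambda>u. (ds2 g x v v * T u + A u * ds2 g x w w) - (ds2 g x v w * B u + B u * ds2 g x v w))) (at x)"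
    by (intro has_derivative_diff has_derivative_mult dv dw dvw)
  then have 1: "((\<lambda>y. ds2 g y v v * ds2 g y w w - ds2 g y v w * ds2 g y v w) has_derivative
      (\<lambda>u. ds2 g x v v * T u)) (at x)"
    by (simp add: z)
  have "((\<lambda>y. (det2 v w)\<^sup>2 * discriminant g y) has_derivative
      (\<lambda>u. (det2 v w)\<^sup>2 * frechet_derivative (discriminant g) (at x) u)) (at x)"
    by (intro has_derivative_mult_right smooth_on_has_derivative[OF smooth_on_discriminant[OF
        D(1,2)] D(3)])
  then have 2: "((\<lambda>y. ds2 g y v v * ds2 g y w w - ds2 g y v w * ds2 g y v w) has_derivative
      (\<lambda>u. (det2 v w)\<^sup>2 * frechet_derivative (discriminant g) (at x) u)) (at x)"
  proof (rule has_derivative_transform_within_open[OF _ D(1,3)])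
    fix y assume "y \<in> D"
    from discriminant_frame[OF smooth_on_linear[OF D(2) this], of v w]
    show "(det2 v w)\<^sup>2 * discriminant g y = ds2 g y v v * ds2 g y w w - ds2 g y v w * ds2 g y v w"
      by (simp only: power2_eq_square)
  qed
  from fun_cong[OF has_derivative_unique[OF 1 2], of u] show ?thesis by (simp add: T_def)
qed

text \<open>Replacing \<open>\<eta>\<close> by \<open>\<phi> \<eta>\<close> multiplies the derivative of \<open>\<langle>df(\<eta>), df(\<eta>)\<rangle>\<close> along the field by \<open>\<phi>\<^sup>3\<close> on the
  lightlike set, since terms with derivatives of \<open>\<phi>\<close> carry the vanishing factor \<open>\<langle>df(\<eta>), df(\<eta>)\<rangle>\<close>. After
  choosing the sign of \<open>\<eta>\<close> to make that derivative positive, its power \<open>-1/3\<close> is a smooth choice of \<open>\<phi>\<close>.\<close>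

lemma normalize_null_vector_field:
  assumes D: "open D" "smooth_on D g" and x: "x \<in> V" "lightlike_in g x"
    and \<eta>: "null_vector_field g D V \<eta>"
    and nz: "lorentz (second_derivative g x (\<eta> x) (\<eta> x)) (frechet_derivative g (at x) (\<eta> x)) \<noteq> 0"
  obtains V' \<eta>' where "x \<in> V'" "normalized_null_vector_field g D V' \<eta>'"
proof -
  have V: "open V" "V \<subseteq> D" and s\<eta>: "smooth_on V \<eta>"
    and null: "\<And>q. q \<in> LD_in g D \<inter> V \<Longrightarrow> null_vector g q (\<eta> q)"
    using \<eta> by (auto simp: null_vector_field_def)
  have xD: "x \<in> D" using V x by auto
  define s where "s = sgn (lorentz (second_derivative g x (\<eta> x) (\<eta> x)) (frechet_derivative g (at
      x) (\<eta> x)))"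
  have s0: "s \<noteq> 0" using nz by (simp add: s_def sgn_zero_iff)
  define \<zeta> where "\<zeta> y = s *\<^sub>R \<eta> y" for y
  have s\<zeta>: "smooth_on V \<zeta>"
    unfolding \<zeta>_def by (rule smooth_on_bounded_linear[OF bounded_linear_scaleR_right V(1) s\<eta>])
  have null\<zeta>: "null_vector g q (c *\<^sub>R \<zeta> q)" if q: "q \<in> LD_in g D \<inter> V" and c: "c \<noteq> 0" for q c
  proof -
    have "q \<in> D" using q V by auto
    from linear_cmul[OF ds2_bilinear(1)[OF smooth_on_linear[OF D(2) this]]] null[OF q] c s0
    show ?thesis by (simp add: null_vector_def \<zeta>_def)
  qed
  define h where "h y = ds2 g y (\<zeta> y) (\<zeta> y)" for y
  have sh: "smooth_on V h" unfolding h_def by (rule smooth_on_ds2[OF D V s\<zeta> s\<zeta>])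
  define u where "u y = frechet_derivative h (at y) (\<zeta> y)" for y
  have su: "smooth_on V u" unfolding u_def by (rule smooth_on_frechet_apply[OF V(1) sh s\<zeta>])
  have "u x > 0"
  proof -
    have "x \<in> LD_in g D \<inter> V" using x xD by (simp add: LD_in_def)
    then have n: "null_vector g x (\<zeta> x)" using null\<zeta>[of x 1] by simp
    have dh: "(h has_derivative
        (\<lambda>v. 2 * lorentz (second_derivative g x v (\<zeta> x)) (frechet_derivative g (at x) (\<zeta> x)))) (at x)"
      unfolding h_def
      by (rule has_derivative_ds2_null[OF D xD n has_derivative_ident smooth_on_has_derivative[OF
          s\<zeta> x(1)]])
    note l = smooth_on_linear[OF D(2) xD] and l2 = second_derivative_linear[OF D xD]
    have "u x = 2 * (s * s * (s * lorentz (second_derivative g x (\<eta> x) (\<eta> x)) (frechet_derivative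
        g (at x) (\<eta> x))))"
      unfolding u_def frechet_derivative_at[OF dh, symmetric]
      by (simp add: \<zeta>_def linear_cmul[OF l] linear_cmul[OF l2(1)] linear_cmul[OF l2(2)]
          lorentz_bilinear_simps)
    also have "s * lorentz (second_derivative g x (\<eta> x) (\<eta> x)) (frechet_derivative g (at x) (\<eta> x))
        = \<bar>lorentz (second_derivative g x (\<eta> x) (\<eta> x)) (frechet_derivative g (at x) (\<eta> x))\<bar>"
      unfolding s_def by (simp add: abs_sgn mult.commute)
    finally show ?thesis using nz s0 by (simp add: zero_less_mult_iff) (metis
        linorder_neqE_linordered_idom)
  qed
  define V' where "V' = {y \<in> V. 0 < u y}"
  have oV': "open V'" unfolding V'_def by (rule open_positive_set[OF V(1)
      smooth_on_continuous_on[OF su]])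
  have V'V: "V' \<subseteq> V" by (auto simp: V'_def)
  define \<phi> where "\<phi> y = u y powr (- 1 / 3)" for y
  have s\<phi>: "smooth_on V' \<phi>"
    unfolding \<phi>_def by (rule smooth_on_powr[OF oV' smooth_on_subset[OF su V'V]]) (simp add: V'_def)
  define \<xi> where "\<xi> y = \<phi> y *\<^sub>R \<zeta> y" for y
  have s\<xi>: "smooth_on V' \<xi>"
    unfolding \<xi>_def by (rule smooth_on_bilinear[OF bounded_bilinear_scaleR oV' s\<phi>
        smooth_on_subset[OF s\<zeta> V'V]])
  have null\<xi>: "null_vector g q (\<xi> q)" if "q \<in> LD_in g D \<inter> V'" for q
    unfolding \<xi>_def using that V'V by (intro null\<zeta>) (auto simp: \<phi>_def V'_def)
  have "frechet_derivative (\<lambda>y. ds2 g y (\<xi> y) (\<xi> y)) (at q) (\<xi> q) = 1" if q: "q \<in> LD_in g D \<inter> V'"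
      for q
  proof -
    have qV: "q \<in> V" "q \<in> V'" "q \<in> D" and uq: "u q > 0" using q V'V V by (auto simp: V'_def)
    have n: "null_vector g q (\<zeta> q)" using null\<zeta>[of q 1] q qV by auto
    have dh: "(h has_derivative
        (\<lambda>v. 2 * lorentz (second_derivative g q v (\<zeta> q)) (frechet_derivative g (at q) (\<zeta> q)))) (at q)"
      unfolding h_def
      by (rule has_derivative_ds2_null[OF D qV(3) n has_derivative_ident
          smooth_on_has_derivative[OF s\<zeta> qV(1)]])
    have uq': "u q = 2 * lorentz (second_derivative g q (\<zeta> q) (\<zeta> q)) (frechet_derivative g (at q)
        (\<zeta> q))"
      unfolding u_def frechet_derivative_at[OF dh, symmetric] ..
    have dx: "((\<lambda>y. ds2 g y (\<xi> y) (\<xi> y)) has_derivative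
        (\<lambda>v. 2 * lorentz (second_derivative g q v (\<xi> q)) (frechet_derivative g (at q) (\<xi> q)))) (at q)"
      by (rule has_derivative_ds2_null[OF D qV(3) null\<xi>[OF q] has_derivative_ident
          smooth_on_has_derivative[OF s\<xi> qV(2)]])
    note l = smooth_on_linear[OF D(2) qV(3)] and l2 = second_derivative_linear[OF D qV(3)]
    have "frechet_derivative (\<lambda>y. ds2 g y (\<xi> y) (\<xi> y)) (at q) (\<xi> q) = \<phi> q * \<phi> q * \<phi> q * u q"
      unfolding frechet_derivative_at[OF dx, symmetric] uq'
      by (simp add: \<xi>_def linear_cmul[OF l] linear_cmul[OF l2(1)] linear_cmul[OF l2(2)]
          lorentz_bilinear_simps)
    also have "\<dots> = u q powr (- 1 / 3 + - 1 / 3 + - 1 / 3 + 1)"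
      unfolding \<phi>_def using uq by (simp only: powr_add powr_one)
    also have "\<dots> = 1" using uq by simp
    finally show ?thesis .
  qed
  then have "normalized_null_vector_field g D V' \<xi>"
    unfolding normalized_null_vector_field_def null_vector_field_def
    using oV' V'V V(2) s\<xi> null\<xi> by blast
  moreover have "x \<in> V'" using x \<open>u x > 0\<close> by (simp add: V'_def)
  ultimately show ?thesis using that by blast
qed

text \<open>By the mean value theorem, as a ball contains the segment between its points.\<close>

lemma discriminant_injective_along:
  assumes D: "open D" "smooth_on D g" and B: "ball x r \<subseteq> D"
    and nz: "\<And>y. y \<in> ball x r \<Longrightarrow> frechet_derivative (discriminant g) (at y) w \<noteq> 0"
    and y: "y \<in> ball x r" "z \<in> ball x r" "discriminant g y = 0" "discriminant g z = 0"
    and p: "z - y = c *\<^sub>R w"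
  shows "z = y"
proof -
  define F where "F \<tau> = discriminant g (y + \<tau> *\<^sub>R (c *\<^sub>R w))" for \<tau> :: real
  have seg: "y + \<tau> *\<^sub>R (c *\<^sub>R w) \<in> ball x r" if "0 \<le> \<tau>" "\<tau> \<le> 1" for \<tau>
  proof -
    have "(1 - \<tau>) *\<^sub>R y + \<tau> *\<^sub>R z \<in> ball x r"
      using convex_ball[of x r] y that by (simp add: convex_alt)
    then show ?thesis unfolding p[symmetric] by (simp add: algebra_simps)
  qed
  have d: "(F has_real_derivative c * frechet_derivative (discriminant g) (at (y + \<tau> *\<^sub>R (c *\<^sub>R
      w))) w) (at \<tau>)"
    if "0 \<le> \<tau>" "\<tau> \<le> 1" for \<tau>
  proof -
    have m: "y + \<tau> *\<^sub>R (c *\<^sub>R w) \<in> D" using seg[OF that] B by blast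
    note s = smooth_on_discriminant[OF D]
    have "((\<lambda>\<tau>. y + \<tau> *\<^sub>R (c *\<^sub>R w)) has_derivative (\<lambda>h. h *\<^sub>R (c *\<^sub>R w))) (at \<tau>)"
      by (auto intro!: derivative_eq_intros)
    from has_derivative_compose[OF this smooth_on_has_derivative[OF s m]]
    have "(F has_derivative (\<lambda>h. frechet_derivative (discriminant g) (at (y + \<tau> *\<^sub>R (c *\<^sub>R w))) (h
        *\<^sub>R (c *\<^sub>R w)))) (at \<tau>)"
      unfolding F_def .
    moreover have "frechet_derivative (discriminant g) (at (y + \<tau> *\<^sub>R (c *\<^sub>R w))) (h *\<^sub>R (c *\<^sub>R w))
       = c * frechet_derivative (discriminant g) (at (y + \<tau> *\<^sub>R (c *\<^sub>R w))) w * h" for h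
      using linear_cmul[OF smooth_on_linear[OF s m], of "h * c" w] by (simp add: ac_simps)
    ultimately show ?thesis unfolding has_field_derivative_def by simp
  qed
  obtain \<tau> where \<tau>: "0 < \<tau>" "\<tau> < 1"
    "F 1 - F 0 = (1 - 0) * (c * frechet_derivative (discriminant g) (at (y + \<tau> *\<^sub>R (c *\<^sub>R w))) w)"
    using MVT2[OF zero_less_one d] by blast
  have "F 0 = 0" "F 1 = 0" using y(3,4) by (simp_all add: F_def p[symmetric])
  then have "c * frechet_derivative (discriminant g) (at (y + \<tau> *\<^sub>R (c *\<^sub>R w))) w = 0" using \<tau>(3)
      by simp
  then have "c = 0" using nz[OF seg, of \<tau>] \<tau> by auto
  then show ?thesis using p by simp
qed

text \<open>That a short arc is again a whole neighbourhood in the lightlike set is not automatic, since the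
  given curve could return to the point. Project along the transversal direction \<open>w\<close>: the projected
  curve is strictly monotone, so it fills an interval, and over each value the discriminant has at most
  one zero near \<open>x\<close>.\<close>

lemma LD_curve_restrict:
  assumes D: "open D" "smooth_on D g" and x: "x \<in> D" and \<gamma>: "LD_curve g D x a b \<gamma>"
    and w: "frechet_derivative (discriminant g) (at x) w \<noteq> 0"
    and d: "det2 (vector_derivative \<gamma> (at 0)) w \<noteq> 0"
  obtains \<epsilon> where "\<epsilon> > 0" "\<And>\<delta>. 0 < \<delta> \<Longrightarrow> \<delta> < \<epsilon> \<Longrightarrow> LD_curve g D x (- \<delta>) \<delta> \<gamma>"
proof -
  note c0 = LD_curveD[OF \<gamma>]
  have reg: "\<And>t. t \<in> {a<..<b} \<Longrightarrow> vector_derivative \<gamma> (at t) \<noteq> 0"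
    using \<gamma> unfolding LD_curve_def by blast
  obtain W where W: "open W" "x \<in> W" "W \<subseteq> D" "\<gamma> ` {a<..<b} = LD_in g D \<inter> W"
    using \<gamma> unfolding LD_curve_def by blast
  note sdisc = smooth_on_discriminant[OF D]
  \<comment> \<open>positive exactly where the derivative along \<open>w\<close> has the same sign as at \<open>x\<close>\<close>
  define e where "e y = frechet_derivative (discriminant g) (at y) w * frechet_derivative
      (discriminant g) (at x) w" for y
  have "continuous_on D e"
    unfolding e_def by (intro continuous_intros smooth_on_continuous_on[OF
        smooth_on_frechet_const[OF D(1) sdisc]])
  then have "open {y \<in> D. 0 < e y}" by (rule open_positive_set[OF D(1)])
  moreover have "x \<in> {y \<in> D. 0 < e y}" using x w by (simp add: e_def zero_less_mult_iff) (metis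
      linorder_neqE_linordered_idom)
  ultimately obtain r where r: "r > 0" "ball x r \<subseteq> {y \<in> D. 0 < e y}"
    using open_contains_ball by blast
  have rD: "ball x r \<subseteq> D" using r by auto
  have nz: "frechet_derivative (discriminant g) (at y) w \<noteq> 0" if "y \<in> ball x r" for y
    using r(2) that by (auto simp: e_def)
  define v where "v t = frechet_derivative \<gamma> (at t) 1" for t
  have v: "(\<gamma> has_vector_derivative v t) (at t)" "vector_derivative \<gamma> (at t) = v t" if "t \<in>
      {a<..<b}" for t
    using smooth_curve_has_vector_derivative[OF c0(3) that] by (simp_all add: v_def)
  have d0: "det2 (v 0) w \<noteq> 0" using d v(2)[OF c0(1)] by simp
  \<comment> \<open>the coordinate along \<open>\<gamma>'(0)\<close> in the frame \<open>\<gamma>'(0), w\<close>; it is constant in the direction \<open>w\<close>\<close>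
  define p where "p y = det2 y w / det2 (v 0) w" for y
  have p_linear: "bounded_linear p"
  proof (rule linear_conv_bounded_linear[THEN iffD1])
    show "linear p" by (rule linearI) (simp_all add: p_def det2_def add_divide_distrib
        diff_divide_distrib algebra_simps)
  qed
  have dp: "((\<lambda>t. p (\<gamma> t)) has_real_derivative p (v t)) (at t)" if "t \<in> {a<..<b}" for t
    using bounded_linear.has_vector_derivative[OF p_linear v(1)[OF that]]
    by (simp add: has_real_derivative_iff_has_vector_derivative)
  have cv: "continuous_on {a<..<b} v"
    unfolding v_def by (rule smooth_on_continuous_on[OF smooth_on_frechet_const[OF _ c0(3)]]) simp
  have c\<gamma>: "continuous_on {a<..<b} \<gamma>" by (rule smooth_on_continuous_on[OF c0(3)])
  define I where "I = ({a<..<b} \<inter> \<gamma> -` ball x r) \<inter> {t \<in> {a<..<b}. 0 < p (v t)}"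
  have "open ({a<..<b} \<inter> \<gamma> -` ball x r)"
    by (rule continuous_open_preimage[OF c\<gamma> open_greaterThanLessThan open_ball])
  moreover have "open {t \<in> {a<..<b}. 0 < p (v t)}"
    by (rule open_positive_set[OF open_greaterThanLessThan])
      (rule continuous_on_compose2[OF linear_continuous_on[OF p_linear, of UNIV] cv], simp)
  ultimately have "open I" unfolding I_def by (rule open_Int)
  moreover have "0 \<in> I" using c0(1,2) r(1) d0 by (simp add: I_def p_def)
  ultimately obtain \<epsilon> where \<epsilon>: "\<epsilon> > 0" "ball 0 \<epsilon> \<subseteq> I" using open_contains_ball by blast
  have "LD_curve g D x (- \<delta>) \<delta> \<gamma>" if \<delta>: "0 < \<delta>" "\<delta> < \<epsilon>" for \<delta>
  proof -
    have inI: "t \<in> {a<..<b}" "\<gamma> t \<in> ball x r" "0 < p (v t)" if "- \<delta> \<le> t" "t \<le> \<delta>" for t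
    proof -
      have "t \<in> ball 0 \<epsilon>" using that \<delta> by (simp add: abs_less_iff)
      then have "t \<in> I" using \<epsilon>(2) by blast
      then show "t \<in> {a<..<b}" "\<gamma> t \<in> ball x r" "0 < p (v t)" unfolding I_def by blast+
    qed
    have sub: "{- \<delta><..<\<delta>} \<subseteq> {a<..<b}" using inI(1) by (meson greaterThanLessThan_iff less_imp_le
        subsetI)
    have mono: "p (\<gamma> s) < p (\<gamma> t)" if "- \<delta> \<le> s" "s < t" "t \<le> \<delta>" for s t
    proof (rule DERIV_pos_imp_increasing[OF that(2)])
      fix q assume "s \<le> q" "q \<le> t"
      then have q: "- \<delta> \<le> q" "q \<le> \<delta>" using that by auto
      show "\<exists>k. ((\<lambda>t. p (\<gamma> t)) has_real_derivative k) (at q) \<and> 0 < k"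
        using dp[OF inI(1)[OF q]] inI(3)[OF q] by blast
    qed
    define J where "J = {p (\<gamma> (- \<delta>))<..<p (\<gamma> \<delta>)}"
    define W' where "W' = W \<inter> ball x r \<inter> p -` J"
    have "open (p -` J)"
      using continuous_open_vimage[OF _ linear_continuous_at[OF p_linear]] by (simp add: J_def)
    then have oW': "open W'" unfolding W'_def using W(1) by blast
    have pJ: "p (\<gamma> t) \<in> J" if "t \<in> {- \<delta><..<\<delta>}" for t
      using mono[of "- \<delta>" t] mono[of t \<delta>] that by (simp add: J_def)
    have xW': "x \<in> W'" using pJ[of 0] \<delta> c0(2) W(2) r(1) by (simp add: W'_def)
    have "\<gamma> ` {- \<delta><..<\<delta>} = LD_in g D \<inter> W'"
    proof (intro equalityI subsetI)
      fix y assume "y \<in> \<gamma> ` {- \<delta><..<\<delta>}"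
      then obtain t where t: "t \<in> {- \<delta><..<\<delta>}" "y = \<gamma> t" by blast
      then have "y \<in> LD_in g D \<inter> W" using W(4) sub by blast
      moreover have "y \<in> ball x r" using inI(2)[of t] t by simp
      ultimately show "y \<in> LD_in g D \<inter> W'" using pJ[OF t(1)] t(2) by (simp add: W'_def)
    next
      fix y assume y: "y \<in> LD_in g D \<inter> W'"
      then have yJ: "p (\<gamma> (- \<delta>)) < p y" "p y < p (\<gamma> \<delta>)" and yr: "y \<in> ball x r"
        and yL: "y \<in> D" "lightlike_in g y"
        by (simp_all add: W'_def J_def LD_in_def)
      have "\<exists>t\<ge>- \<delta>. t \<le> \<delta> \<and> p (\<gamma> t) = p y"
      proof (rule IVT)
        show "\<forall>t. - \<delta> \<le> t \<and> t \<le> \<delta> \<longrightarrow> isCont (\<lambda>t. p (\<gamma> t)) t"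
          using DERIV_isCont[OF dp] inI(1) by blast
      qed (use yJ \<delta> in auto)
      then obtain t where t: "- \<delta> \<le> t" "t \<le> \<delta>" "p (\<gamma> t) = p y" by blast
      have "t \<noteq> - \<delta>" "t \<noteq> \<delta>" using t(3) yJ by auto
      then have tI: "t \<in> {- \<delta><..<\<delta>}" using t by simp
      have "det2 (y - \<gamma> t) w = 0" using t(3) d0 by (simp add: p_def det2_def algebra_simps)
      moreover have "w \<noteq> 0" using d0 by (auto simp: det2_def)
      ultimately obtain c where c: "y - \<gamma> t = c *\<^sub>R w" using det2_zero by blast
      have \<gamma>L: "\<gamma> t \<in> D" "lightlike_in g (\<gamma> t)" using LD_curve_in[OF \<gamma> inI(1)[OF t(1,2)]] .
      have "y = \<gamma> t"
        by (rule discriminant_injective_along[OF D rD nz inI(2)[OF t(1,2)] yr _ _ c])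
          (use lightlike_discriminant[OF smooth_on_linear[OF D(2)]] yL \<gamma>L in blast)+
      then show "y \<in> \<gamma> ` {- \<delta><..<\<delta>}" using tI by blast
    qed
    moreover have "W' \<subseteq> D" using W(3) by (auto simp: W'_def)
    moreover have "\<forall>t\<in>{- \<delta><..<\<delta>}. vector_derivative \<gamma> (at t) \<noteq> 0" using reg sub by blast
    moreover have "smooth_on {- \<delta><..<\<delta>} \<gamma>" by (rule smooth_on_subset[OF c0(3) sub])
    moreover have "- \<delta> < 0" "0 < \<delta>" using \<delta> by auto
    ultimately show ?thesis unfolding LD_curve_def using oW' xW' c0(2) by blast
  qed
  then show ?thesis using that \<epsilon>(1) by blast
qed

text \<open>The arc length parameter solves \<open>\<sigma>' = 1 / |(g \<circ> \<gamma>)'(\<sigma>)|\<close>.\<close>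

lemma LD_curve_unit_speed:
  assumes D: "open D" "smooth_on D g"
    and \<epsilon>: "\<epsilon> > 0" "\<And>\<delta>. 0 < \<delta> \<Longrightarrow> \<delta> < \<epsilon> \<Longrightarrow> LD_curve g D x (- \<delta>) \<delta> \<gamma>"
    and pos: "ds2 g x (vector_derivative \<gamma> (at 0)) (vector_derivative \<gamma> (at 0)) > 0"
  obtains a b \<theta> where "LD_curve g D x a b \<theta>"
    "\<And>t. t \<in> {a<..<b} \<Longrightarrow> lorentz_norm (vector_derivative (g \<circ> \<theta>) (at t)) = 1"
proof -
  define I where "I = {- (\<epsilon> / 2)<..<\<epsilon> / 2}"
  have LI: "LD_curve g D x (- (\<epsilon> / 2)) (\<epsilon> / 2) \<gamma>" using \<epsilon> by simp
  have oI: "open I" and zI: "0 \<in> I" and \<gamma>0: "\<gamma> 0 = x" and s\<gamma>: "smooth_on I \<gamma>"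
    using LD_curveD[OF LI] by (simp_all add: I_def)
  have \<gamma>D: "\<gamma> t \<in> D" if "t \<in> I" for t using LD_curve_in(1)[OF LI] that unfolding I_def .
  define v where "v t = frechet_derivative \<gamma> (at t) 1" for t
  have v: "(\<gamma> has_vector_derivative v t) (at t)" "vector_derivative \<gamma> (at t) = v t" if "t \<in> I" for t
    using smooth_curve_has_vector_derivative[OF s\<gamma>[unfolded I_def]] that by (simp_all add: v_def
        I_def)
  define E where "E t = lorentz (frechet_derivative g (at (\<gamma> t)) (v t)) (frechet_derivative g (at
      (\<gamma> t)) (v t))" for t
  have sg\<gamma>: "smooth_on I (\<lambda>t. g (\<gamma> t))"
    by (rule smooth_on_compose[OF oI D(1) _ s\<gamma> D(2)]) (use \<gamma>D in blast)
  have lift: "frechet_derivative (\<lambda>t. g (\<gamma> t)) (at t) 1 = frechet_derivative g (at (\<gamma> t)) (v t)"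
      if t: "t \<in> I" for t
    using lift_curve_vector_derivative[OF D(2) s\<gamma>[unfolded I_def] t[unfolded I_def] \<gamma>D[OF t]]
      smooth_curve_has_vector_derivative(2)[OF sg\<gamma>[unfolded I_def] t[unfolded I_def]]
    by (simp add: v_def o_def)
  have sE: "smooth_on I E"
  proof (rule smooth_on_cong[OF oI])
    note s = smooth_on_frechet_const[OF oI sg\<gamma>, of 1]
    show "smooth_on I (\<lambda>t. lorentz (frechet_derivative (\<lambda>t. g (\<gamma> t)) (at t) 1) (frechet_derivative
        (\<lambda>t. g (\<gamma> t)) (at t) 1))"
      by (rule smooth_on_bilinear[OF bounded_bilinear_lorentz oI s s])
  qed (simp add: lift E_def)
  have "open {t \<in> I. 0 < E t}" by (rule open_positive_set[OF oI smooth_on_continuous_on[OF sE]])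
  moreover have "0 \<in> {t \<in> I. 0 < E t}"
    using pos zI v(2)[OF zI] by (simp add: E_def \<gamma>0 ds2_def)
  ultimately obtain \<rho> where \<rho>: "\<rho> > 0" "ball 0 \<rho> \<subseteq> {t \<in> I. 0 < E t}" using open_contains_ball by blast
  define \<delta> where "\<delta> = min (\<rho> / 2) (\<epsilon> / 2)"
  have \<delta>: "0 < \<delta>" "\<delta> < \<rho>" "\<delta> < \<epsilon>" using \<rho>(1) \<epsilon>(1) by (auto simp: \<delta>_def)
  have in\<rho>: "t \<in> I" "0 < E t" if "t \<in> {- \<rho><..<\<rho>}" for t
  proof -
    have "t \<in> ball 0 \<rho>" using that by (simp add: abs_less_iff)
    then show "t \<in> I" "0 < E t" using \<rho>(2) by blast+
  qed
  then have \<rho>I: "{- \<rho><..<\<rho>} \<subseteq> I" by blast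
  \<comment> \<open>the reciprocal of the speed\<close>
  define P where "P t = E t powr (- 1 / 2)" for t
  have sP: "smooth_on {- \<rho><..<\<rho>} P"
    unfolding P_def by (rule smooth_on_powr[OF _ smooth_on_subset[OF sE \<rho>I]]) (use in\<rho>(2) in simp_all)
  have Ppos: "P t > 0" if "t \<in> {- \<rho><..<\<rho>}" for t using in\<rho>(2)[OF that] by (simp add: P_def)
  have PE: "P t * P t * E t = 1" if "t \<in> {- \<rho><..<\<rho>}" for t
  proof -
    have "P t * P t * E t = E t powr (- 1 / 2 + - 1 / 2 + 1)"
      unfolding P_def using in\<rho>(2)[OF that] by (simp only: powr_add powr_one)
    then show ?thesis using in\<rho>(2)[OF that] by simp
  qed
  obtain c' d' \<sigma> where \<sigma>: "c' < 0" "0 < d'" "\<sigma> 0 = 0" "\<sigma> ` {c'<..<d'} = {- \<delta><..<\<delta>}"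
    "smooth_on {c'<..<d'} \<sigma>" "\<And>t. t \<in> {c'<..<d'} \<Longrightarrow> (\<sigma> has_real_derivative P (\<sigma> t)) (at t)"
    by (rule inverse_antiderivative[OF sP Ppos, of "- \<delta>" \<delta>]) (use \<delta> in auto)
  have L: "LD_curve g D x (- \<delta>) \<delta> \<gamma>" by (rule \<epsilon>(2)[OF \<delta>(1,3)])
  have \<sigma>\<rho>: "\<sigma> t \<in> {- \<rho><..<\<rho>}" if "t \<in> {c'<..<d'}" for t
  proof -
    have "\<sigma> t \<in> {- \<delta><..<\<delta>}" using \<sigma>(4) that by blast
    then show ?thesis using \<delta>(2) by simp
  qed
  define \<theta> where "\<theta> t = \<gamma> (\<sigma> t)" for t
  have d\<theta>: "(\<theta> has_vector_derivative P (\<sigma> t) *\<^sub>R v (\<sigma> t)) (at t)" if t: "t \<in> {c'<..<d'}" for t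
    using vector_diff_chain_at[OF \<sigma>(6)[OF t, unfolded
        has_real_derivative_iff_has_vector_derivative] v(1)[OF in\<rho>(1)[OF \<sigma>\<rho>[OF t]]]]
    by (simp add: \<theta>_def[abs_def] o_def)
  have s\<theta>: "smooth_on {c'<..<d'} \<theta>"
    unfolding \<theta>_def
    by (rule smooth_on_compose[OF _ oI _ \<sigma>(5) s\<gamma>]) (use in\<rho>(1)[OF \<sigma>\<rho>] in auto)
  have "LD_curve g D x c' d' \<theta>"
    unfolding LD_curve_def
  proof (intro conjI ballI)
    show "c' < 0" "0 < d'" "smooth_on {c'<..<d'} \<theta>" by fact+
    show "\<theta> 0 = x" by (simp add: \<theta>_def \<sigma>(3) \<gamma>0)
  next
    fix t assume t: "t \<in> {c'<..<d'}"
    have "\<sigma> t \<in> {- \<delta><..<\<delta>}" using \<sigma>(4) t by blast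
    then have "vector_derivative \<gamma> (at (\<sigma> t)) \<noteq> 0" using L unfolding LD_curve_def by blast
    then show "vector_derivative \<theta> (at t) \<noteq> 0"
      using vector_derivative_at[OF d\<theta>[OF t]] v(2)[OF in\<rho>(1)[OF \<sigma>\<rho>[OF t]]] Ppos[OF \<sigma>\<rho>[OF t]] by simp
  next
    have "\<theta> ` {c'<..<d'} = \<gamma> ` {- \<delta><..<\<delta>}" unfolding \<theta>_def \<sigma>(4)[symmetric] by (simp add: image_image)
    then show "\<exists>W. open W \<and> x \<in> W \<and> W \<subseteq> D \<and> \<theta> ` {c'<..<d'} = LD_in g D \<inter> W"
      using L unfolding LD_curve_def by simp
  qed
  moreover have "lorentz_norm (vector_derivative (g \<circ> \<theta>) (at t)) = 1" if t: "t \<in> {c'<..<d'}" for t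
  proof -
    note i = \<sigma>\<rho>[OF t]
    have \<theta>D: "\<theta> t \<in> D" using \<gamma>D[OF in\<rho>(1)[OF i]] by (simp add: \<theta>_def)
    have "frechet_derivative \<theta> (at t) 1 = P (\<sigma> t) *\<^sub>R v (\<sigma> t)"
      using smooth_curve_has_vector_derivative(2)[OF s\<theta> t] vector_derivative_at[OF d\<theta>[OF t]] by simp
    then have "vector_derivative (g \<circ> \<theta>) (at t) = P (\<sigma> t) *\<^sub>R frechet_derivative g (at (\<gamma> (\<sigma> t)))
        (v (\<sigma> t))"
      using lift_curve_vector_derivative[OF D(2) s\<theta> t \<theta>D] linear_cmul[OF smooth_on_linear[OF D(2) \<theta>D]]
      by (simp add: \<theta>_def[of t])
    then have "lorentz (vector_derivative (g \<circ> \<theta>) (at t)) (vector_derivative (g \<circ> \<theta>) (at t)) = P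
        (\<sigma> t) * P (\<sigma> t) * E (\<sigma> t)"
      by (simp add: lorentz_bilinear_simps E_def)
    then show ?thesis by (simp add: lorentz_norm_def PE[OF i])
  qed
  ultimately show ?thesis using that by blast
qed

text \<open>With \<open>B(u, w) = \<langle>D\<^sup>2g(u, w), dg(w)\<rangle>\<close> and \<open>\<lambda>\<close> the discriminant, \<open>d\<lambda>\<close> is a positive multiple of
  \<open>ds\<^sup>2(v, v) B(\<cdot>, w)\<close>. As \<open>B(v, w) = 0\<close>, the hypothesis
  \<open>d\<lambda> \<noteq> 0\<close> gives at once that \<open>v\<close> is spacelike, that \<open>B(w, w) \<noteq> 0\<close>, and that \<open>\<lambda>\<close> has nonzero derivative
  along \<open>w\<close>.\<close>

lemma lightlike_singular_curvature_exists:
  assumes D: "open D" "smooth_on D g" "x \<in> D" and inj: "inj (frechet_derivative g (at x))"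
    and fk: "first_kind_in g D x"
  obtains k where "is_lightlike_singular_curvature_in g D x k"
proof -
  obtain a b \<gamma> V \<eta> where \<gamma>: "LD_curve g D x a b \<gamma>" and V: "x \<in> V" "null_vector_field g D V \<eta>"
    and ne: "vector_derivative \<gamma> (at 0) \<noteq> \<eta> x" and indep: "independent {vector_derivative \<gamma> (at
        0), \<eta> x}"
    and ll: "lightlike_in g x" and nd: "frechet_derivative (discriminant g) (at x) \<noteq> (\<lambda>_. 0)"
    using fk unfolding first_kind_in_def nondegenerate_lightlike_in_def by blast
  define v where "v = vector_derivative \<gamma> (at 0)"
  define w where "w = \<eta> x"
  note l = smooth_on_linear[OF D(2,3)] and l2 = second_derivative_linear[OF D]
  have null: "null_vector g x w"
    using V ll D(3) unfolding null_vector_field_def LD_in_def w_def by blast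
  have det: "det2 v w \<noteq> 0"
  proof
    assume "det2 v w = 0"
    moreover have "w \<noteq> 0" using null by (simp add: null_vector_def)
    ultimately obtain c where "v = c *\<^sub>R w" using det2_zero by blast
    then have "v \<in> span {w}" by (simp add: span_base span_scale)
    moreover have "v \<noteq> w" using ne by (simp add: v_def w_def)
    ultimately have "dependent {v, w}" unfolding dependent_def by (intro bexI[of _ v]) (auto simp:
        insert_Diff_if)
    then show False using indep by (simp add: v_def w_def)
  qed
  define A where "A u = lorentz (second_derivative g x u w) (frechet_derivative g (at x) w)" for u
  have lA: "A (c *\<^sub>R u + c' *\<^sub>R u') = c * A u + c' * A u'" for c c' u u'
    by (simp add: A_def linear_add[OF l2(1)] linear_cmul[OF l2(1)] lorentz_bilinear_simps)
  have dA: "(det2 v w)\<^sup>2 * frechet_derivative (discriminant g) (at x) u = 2 * ds2 g x v v * A u" for u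
    unfolding A_def by (rule discriminant_derivative_null[OF D null])
  have Av: "A v = 0" unfolding A_def v_def w_def by (rule null_field_along_LD_curve[OF D \<gamma> V])
  obtain u where u: "frechet_derivative (discriminant g) (at x) u \<noteq> 0" using nd by auto
  have Au: "A u = det2 v u / det2 v w * A w"
    using lA[of "det2 u w / det2 v w" v "det2 v u / det2 v w" w] det2_expansion[OF det, of u] Av
        by simp
  have nz: "ds2 g x v v \<noteq> 0" "A w \<noteq> 0" using dA[of u] u det Au by auto
  then have dw: "frechet_derivative (discriminant g) (at x) w \<noteq> 0" using dA[of w] by auto
  have pos: "ds2 g x v v > 0" using null_vector_complement_nonneg[OF null l inj, of v] nz(1) by simp
  obtain V' \<eta>' where \<eta>': "x \<in> V'" "normalized_null_vector_field g D V' \<eta>'"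
    using normalize_null_vector_field[OF D(1,2) V(1) ll V(2)] nz(2) unfolding A_def w_def by blast
  obtain \<epsilon> where \<epsilon>: "\<epsilon> > 0" "\<And>\<delta>. 0 < \<delta> \<Longrightarrow> \<delta> < \<epsilon> \<Longrightarrow> LD_curve g D x (- \<delta>) \<delta> \<gamma>"
    using LD_curve_restrict[OF D \<gamma> dw det[unfolded v_def]] by blast
  obtain a' b' \<theta> where "LD_curve g D x a' b' \<theta>"
    "\<And>t. t \<in> {a'<..<b'} \<Longrightarrow> lorentz_norm (vector_derivative (g \<circ> \<theta>) (at t)) = 1"
    using LD_curve_unit_speed[OF D(1,2) \<epsilon> pos[unfolded v_def]] by blast
  then have "is_lightlike_singular_curvature_in g D x
     (lorentz (vector_derivative (\<lambda>t. vector_derivative (g \<circ> \<theta>) (at t)) (at 0)) (tangent_map g (\<theta>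
         0) (\<eta>' (\<theta> 0))))"
    unfolding is_lightlike_singular_curvature_in_def using \<eta>' by blast
  then show ?thesis by (rule that)
qed

section \<open>Surfaces and their charts\<close>

lemma surface_chart:
  assumes "surface X A f" "c \<in> A"
  shows "openin X (fst c)" "open (coord_dom c)" "inj_on (snd c) (fst c)"
    "homeomorphic_map (subtopology X (fst c)) (top_of_set (coord_dom c)) (snd c)"
    "smooth_on (coord_dom c) (coord_rep f c)"
    "\<And>x. x \<in> coord_dom c \<Longrightarrow> inj (frechet_derivative (coord_rep f c) (at x))"
proof -
  show U: "openin X (fst c)" and "open (coord_dom c)"
    and h: "homeomorphic_map (subtopology X (fst c)) (top_of_set (coord_dom c)) (snd c)"
    using assms unfolding surface_def smooth_2_manifold_def by blast+
  show "inj_on (snd c) (fst c)"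
    using homeomorphic_imp_injective_map[OF h] openin_subset[OF U] by (simp add: Int_absorb1)
  show "smooth_on (coord_dom c) (coord_rep f c)"
    "\<And>x. x \<in> coord_dom c \<Longrightarrow> inj (frechet_derivative (coord_rep f c) (at x))"
    using assms unfolding surface_def smooth_immersion_def by blast+
qed

lemma coord_rep_chart:
  assumes "surface X A f" "c \<in> A" "q \<in> fst c"
  shows "coord_rep h c (snd c q) = h q" "snd c q \<in> coord_dom c"
proof -
  show "coord_rep h c (snd c q) = h q"
    using inv_into_f_f[OF surface_chart(3)[OF assms(1,2)] assms(3)] by (simp add: coord_rep_def)
  show "snd c q \<in> coord_dom c" unfolding coord_dom_def using assms(3) by (rule imageI)
qed

lemma openin_chart_preimage:
  assumes "surface X A f" "c \<in> A" "open U"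
  shows "openin X {q \<in> fst c. snd c q \<in> U}"
proof -
  note ch = surface_chart[OF assms(1,2)]
  have "continuous_map (subtopology X (fst c)) (top_of_set (coord_dom c)) (snd c)"
    using ch(4) by (rule homeomorphic_imp_continuous_map)
  moreover have "openin (top_of_set (coord_dom c)) (coord_dom c \<inter> U)" using assms(3) by auto
  ultimately have "openin (subtopology X (fst c)) {q \<in> topspace (subtopology X (fst c)). snd c q \<in>
      coord_dom c \<inter> U}"
    by (rule openin_continuous_map_preimage)
  moreover have "{q \<in> topspace (subtopology X (fst c)). snd c q \<in> coord_dom c \<inter> U} = {q \<in> fst c.
      snd c q \<in> U}"
    using openin_subset[OF ch(1)] by (auto simp: coord_dom_def)
  ultimately show ?thesis using ch(1) by (metis openin_trans_full)
qed

lemma coordinate_change_charts: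
  assumes s: "surface X A f" and c: "c \<in> A" "q \<in> fst c" and d: "d \<in> A" "q \<in> fst d"
  shows "coordinate_change (coord_rep f c) (coord_rep f d) (coord_rep (snd c) d) (coord_dom c)
    (snd d ` (fst d \<inter> fst c)) (snd d q)"
proof
  show "open (coord_dom c)" "smooth_on (coord_dom c) (coord_rep f c)" by (rule surface_chart[OF s
      c(1)])+
  show "open (snd d ` (fst d \<inter> fst c))"
  proof -
    have "openin (subtopology X (fst d)) (fst d \<inter> fst c)"
      using surface_chart(1)[OF s c(1)] by (auto simp: openin_subtopology)
    then have "openin (top_of_set (coord_dom d)) (snd d ` (fst d \<inter> fst c))"
      using homeomorphic_imp_open_map[OF surface_chart(4)[OF s d(1)]] by (simp add: open_map_def)
    then show ?thesis using surface_chart(2)[OF s d(1)] openin_open_trans by blast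
  qed
  show "smooth_on (snd d ` (fst d \<inter> fst c)) (coord_rep (snd c) d)"
    using s c(1) d(1) unfolding surface_def smooth_2_manifold_def by blast
  show "coord_rep (snd c) d ` snd d ` (fst d \<inter> fst c) \<subseteq> coord_dom c"
    using coord_rep_chart(2)[OF s c(1)] coord_rep_chart(1)[OF s d(1), of _ "snd c"] by auto
  show "coord_rep f d y = coord_rep f c (coord_rep (snd c) d y)" if "y \<in> snd d ` (fst d \<inter> fst c)"
      for y
    using that coord_rep_chart(1)[OF s c(1), of _ f] coord_rep_chart(1)[OF s d(1), of _ f]
      coord_rep_chart(1)[OF s d(1), of _ "snd c"] by auto
  show "snd d q \<in> snd d ` (fst d \<inter> fst c)" using c d by blast
  show "inj (frechet_derivative (coord_rep f c) (at (coord_rep (snd c) d (snd d q))))"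
    using surface_chart(6)[OF s c(1)] coord_rep_chart(2)[OF s c] coord_rep_chart(1)[OF s d, of
        "snd c"] by simp
  show "inj (frechet_derivative (coord_rep f d) (at (snd d q)))"
    by (rule surface_chart(6)[OF s d(1) coord_rep_chart(2)[OF s d]])
qed

text \<open>Once the definite description is known to be met, in some chart at \<open>p\<close>, the adapted frame in that
  chart gives the sign of the Gaussian curvature.\<close>

lemma lightlike_singular_curvature_sgn:
  assumes s: "surface X A f" and fk: "first_kind A f p"
  obtains c where "c \<in> A" "p \<in> fst c"
    "sgn (gauss_curvature_in (coord_rep f c) (snd c p)) = sgn (lightlike_singular_curvature A f p)"
proof -
  let ?K = "\<lambda>k. \<exists>c\<in>A. p \<in> fst c \<and> is_lightlike_singular_curvature_in (coord_rep f c) (coord_dom c)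
      (snd c p) k"
  have frame: "\<exists>v w. first_kind_frame (coord_rep f c) (snd c p) v w k"
    if c: "c \<in> A" "p \<in> fst c" and k: "is_lightlike_singular_curvature_in (coord_rep f c)
        (coord_dom c) (snd c p) k" for c k
    using lightlike_singular_curvature_frame[OF surface_chart(2,5)[OF s c(1)]
        coord_rep_chart(2)[OF s c]
        surface_chart(6)[OF s c(1) coord_rep_chart(2)[OF s c]] k] by blast
  obtain c\<^sub>0 where c0: "c\<^sub>0 \<in> A" "p \<in> fst c\<^sub>0" "first_kind_in (coord_rep f c\<^sub>0) (coord_dom c\<^sub>0)
      (snd c\<^sub>0 p)"
    using fk unfolding first_kind_def by blast
  obtain k\<^sub>0 where k0: "is_lightlike_singular_curvature_in (coord_rep f c\<^sub>0) (coord_dom c\<^sub>0) (snd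
      c\<^sub>0 p) k\<^sub>0"
    using lightlike_singular_curvature_exists[OF surface_chart(2,5)[OF s c0(1)]
        coord_rep_chart(2)[OF s c0(1,2)]
        surface_chart(6)[OF s c0(1) coord_rep_chart(2)[OF s c0(1,2)]] c0(3)] by blast
  have unique: "k = k\<^sub>0" if "?K k" for k
  proof -
    obtain d where d: "d \<in> A" "p \<in> fst d" "is_lightlike_singular_curvature_in (coord_rep f d)
        (coord_dom d) (snd d p) k"
      using \<open>?K k\<close> by blast
    obtain v w where f2: "first_kind_frame (coord_rep f d) (snd d p) v w k" using frame[OF d] by blast
    obtain v' w' where f1: "first_kind_frame (coord_rep f c\<^sub>0) (snd c\<^sub>0 p) v' w' k\<^sub>0"
      using frame[OF c0(1,2) k0] by blast
    have t: "coord_rep (snd c\<^sub>0) d (snd d p) = snd c\<^sub>0 p" by (rule coord_rep_chart(1)[OF s d(1,2)])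
    show ?thesis
      using coordinate_change.first_kind_frame_transfer[OF coordinate_change_charts[OF s c0(1,2)
          d(1,2)] f2]
      unfolding t
      by (rule first_kind_frame_unique[OF surface_chart(2,5)[OF s c0(1)] coord_rep_chart(2)[OF s
          c0(1,2)] f1])
  qed
  have "?K (lightlike_singular_curvature A f p)"
    unfolding lightlike_singular_curvature_def
  proof (rule theI)
    show "?K k\<^sub>0" using c0(1,2) k0 by blast
  qed (rule unique)
  then obtain c where c: "c \<in> A" "p \<in> fst c"
    "is_lightlike_singular_curvature_in (coord_rep f c) (coord_dom c) (snd c p)
        (lightlike_singular_curvature A f p)"
    by blast
  obtain v w where "first_kind_frame (coord_rep f c) (snd c p) v w (lightlike_singular_curvature A
      f p)"
    using frame[OF c] by blast
  from first_kind_frame_gauss_curvature[OF surface_chart(2,5)[OF s c(1)] coord_rep_chart(2)[OF s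
      c(1,2)]
      surface_chart(6)[OF s c(1) coord_rep_chart(2)[OF s c(1,2)]] this]
  show ?thesis by (rule that[OF c(1,2)])
qed

lemma on_one_side_subset:
  assumes "on_one_side S P" "T \<subseteq> S"
  shows "on_one_side T P"
proof -
  obtain n d where "n \<noteq> 0" "P = {y. n \<bullet> y = d}" "S \<subseteq> {y. n \<bullet> y \<ge> d}"
    using assms(1) unfolding on_one_side_def by blast
  with subset_trans[OF assms(2) this(3)] show ?thesis unfolding on_one_side_def by blast
qed

theorem corollary5p7:
  fixes X :: "'a topology" and A :: "'a chart set" and f :: "'a \<Rightarrow> real^3" and p :: 'a
  assumes "surface X A f"
    and "mixed_type A f"
    and "p \<in> topspace X"
    and "first_kind A f p"
  shows "(lightlike_singular_curvature A f p < 0 \<longrightarrow> saddle_shaped_near X A f p) \<and>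
         (lightlike_singular_curvature A f p > 0 \<longrightarrow> locally_convex_near X A f p)"
proof -
  note s = assms(1)
  obtain c where c: "c \<in> A" "p \<in> fst c"
    and sgn: "sgn (gauss_curvature_in (coord_rep f c) (snd c p)) = sgn
        (lightlike_singular_curvature A f p)"
    using lightlike_singular_curvature_sgn[OF s assms(4)] .
  let ?g = "coord_rep f c" and ?D = "coord_dom c"
  note ch = surface_chart[OF s c(1)]
  have K: "continuous_on ?D (gauss_curvature_in ?g)"
    by (rule continuous_on_gauss_curvature[OF ch(2,5,6)])
  have pD: "snd c p \<in> ?D" by (rule coord_rep_chart(2)[OF s c])
  have "saddle_shaped_near X A f p" if neg: "lightlike_singular_curvature A f p < 0"
  proof -
    have "gauss_curvature_in ?g (snd c p) < 0" using sgn neg by (simp add: sgn_if split: if_splits)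
    define W where "W = {q \<in> fst c. snd c q \<in> {y \<in> ?D. 0 < - gauss_curvature_in ?g y}}"
    have "openin X W"
      unfolding W_def
      by (rule openin_chart_preimage[OF s c(1) open_positive_set[OF ch(2) continuous_on_minus[OF K]]])
    moreover have "p \<in> W" using c(2) pD \<open>gauss_curvature_in ?g (snd c p) < 0\<close> by (simp add: W_def)
    moreover have "gauss_curvature_in (coord_rep f d) (snd d q) < 0"
      if q: "q \<in> W" and d: "d \<in> A" "q \<in> fst d" for q d
    proof -
      have qc: "q \<in> fst c" "gauss_curvature_in ?g (snd c q) < 0" using q by (auto simp: W_def)
      have "sgn (gauss_curvature_in (coord_rep f d) (snd d q)) = sgn (gauss_curvature_in ?g (snd c
          q))"
        using coordinate_change.reparametrized_sgn_gauss_curvature[OF coordinate_change_charts[OF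
            s c(1) qc(1) d]]
        unfolding coord_rep_chart(1)[OF s d] .
      then show ?thesis using qc(2) by (simp add: sgn_if split: if_splits)
    qed
    ultimately show ?thesis unfolding saddle_shaped_near_def by blast
  qed
  moreover have "locally_convex_near X A f p" if pos: "lightlike_singular_curvature A f p > 0"
  proof -
    have "gauss_curvature_in ?g (snd c p) > 0" using sgn pos by (simp add: sgn_if split: if_splits)
    define W where "W = {q \<in> fst c. snd c q \<in> {y \<in> ?D. 0 < gauss_curvature_in ?g y}}"
    have "openin X W"
      unfolding W_def by (rule openin_chart_preimage[OF s c(1) open_positive_set[OF ch(2) K]])
    moreover have "p \<in> W" using c(2) pD \<open>gauss_curvature_in ?g (snd c p) > 0\<close> by (simp add: W_def)
    moreover have "one_sided_at X A f q" if q: "q \<in> W" for q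
    proof -
      have qc: "q \<in> fst c" "snd c q \<in> ?D" "gauss_curvature_in ?g (snd c q) > 0" using q by (auto
          simp: W_def)
      obtain r where r: "r > 0" "ball (snd c q) r \<subseteq> ?D"
        "on_one_side (?g ` ball (snd c q) r) (affine_tangent_plane_in ?g (snd c q))"
        using convex_near_positive_gauss_curvature[OF ch(2,5) qc(2) ch(6)[OF qc(2)] qc(3)] .
      define U where "U = {q' \<in> fst c. snd c q' \<in> ball (snd c q) r}"
      have "openin X U" unfolding U_def by (rule openin_chart_preimage[OF s c(1) open_ball])
      moreover have "q \<in> U" using qc(1) r(1) by (simp add: U_def)
      moreover have "on_one_side (f ` U) (affine_tangent_plane_in (coord_rep f d) (snd d q))"
        if d: "d \<in> A" "q \<in> fst d" for d
      proof -
        have "f ` U \<subseteq> ?g ` ball (snd c q) r"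
        proof
          fix y assume "y \<in> f ` U"
          then obtain q' where q': "q' \<in> fst c" "snd c q' \<in> ball (snd c q) r" "y = f q'"
            by (auto simp: U_def)
          then have "y = ?g (snd c q')" using coord_rep_chart(1)[OF s c(1) q'(1), of f] by simp
          then show "y \<in> ?g ` ball (snd c q) r" using q'(2) by blast
        qed
        moreover have "affine_tangent_plane_in (coord_rep f d) (snd d q) = affine_tangent_plane_in
            ?g (snd c q)"
          using coordinate_change.reparametrized_tangent_plane[OF coordinate_change_charts[OF s
              c(1) qc(1) d]]
          unfolding coord_rep_chart(1)[OF s d] .
        ultimately show ?thesis using on_one_side_subset[OF r(3)] by simp
      qed
      ultimately show ?thesis unfolding one_sided_at_def by blast
    qed
    ultimately show ?thesis unfolding locally_convex_near_def by blast
  qed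
  ultimately show ?thesis by blast
qed

end
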